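(* The set $\mathrm{Nrm}(\mu_{\mathrm{H}})$ of Hurwitz normal numbers is $\mathbf{\Pi}^0_3(\mathbb{C})$-complete; that is, $\mathrm{Nrm}(\mu_{\mathrm{H}})\in\mathbf{\Pi}^0_3(\mathbb{C})$ and $\mathrm{Nrm}(\mu_{\mathrm{H}})\notin\mathbf{\Sigma}^0_3(\mathbb{C})$.
   Context: For $z\in\mathbb{C}$, $[z]:=\lfloor \mathrm{Re}(z)+\tfrac12\rfloor+i\lfloor \mathrm{Im}(z)+\tfrac12\rfloor$; $\mathfrak{F}:=\{z: -\tfrac12\le \mathrm{Re}(z)<\tfrac12,\ -\tfrac12\le \mathrm{Im}(z)<\tfrac12\}$; $T(0)=0$, $T(z)=z^{-1}-[z^{-1}]$ for $z\ne0$; $a_1(z)=[z^{-1}]$, $a_n(z)=a_1(T^{n-1}(z))$ when $T^{n-1}(z)\ne0$. Cylinders $\mathcal{C}_n(b_1,\dots,b_n):=\{z\in\mathfrak{F}:a_j(z)=b_j,\ 1\le j\le n\}$; a word $(b_1,\dots,b_n)$ is regular if $\mathcal{C}_n(b_1,\dots,b_n)$ has nonempty interior. $\mu_{\mathrm{H}}$ is the unique $T$-ergodic Borel probability measure on $\mathfrak{F}$ equivalent to Lebesgue measure. $z\in\mathfrak{F}\setminus\mathbb{Q}(i)$ is Hurwitz normal if for every $n$ and every regular word $\mathbf{b}$ of length $n$, $\lim_{N\to\infty}\frac1N\#\{j\in\{0,\dots,N-1\}:(a_{j+1}(z),\dots,a_{j+n}(z))=\mathbf{b}\}=\mu_{\mathrm{H}}(\mathcal{C}_n(\mathbf{b}))$;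 $\mathrm{Nrm}(\mu_{\mathrm{H}})$ is the set of such $z$. Borel hierarchy on a Polish space $X$: $\mathbf{\Sigma}^0_1(X)$ is the family of open sets; for $1\le\xi<\omega_1$, $\mathbf{\Pi}^0_\xi(X)$ consists of complements of sets in $\mathbf{\Sigma}^0_\xi(X)$, and $\mathbf{\Sigma}^0_\xi(X)$ consists of countable unions of sets $A_n\in\mathbf{\Pi}^0_{\xi_n}(X)$ with $\xi_n<\xi$. *)

theory Defs
  imports "HOL-Probability.Probability"
begin

definition hurwitz_round :: "complex \<Rightarrow> complex" where
  "hurwitz_round z = Complex (of_int \<lfloor>Re z + 1/2\<rfloor>) (of_int \<lfloor>Im z + 1/2\<rfloor>)"

definition hurwitz_domain :: "complex set" where
  "hurwitz_domain = {z. -1/2 \<le> Re z \<and> Re z < 1/2 \<and> -1/2 \<le> Im z \<and> Im z < 1/2}"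

definition hurwitz_map :: "complex \<Rightarrow> complex" where
  "hurwitz_map z = (if z = 0 then 0 else inverse z - hurwitz_round (inverse z))"

text \<open>The digit of index \<open>n \<ge> 1\<close>. It is only meaningful if the \<open>(n - 1)\<close>-st iterate of
  \<open>z\<close> is nonzero; this is required explicitly in the definition of cylinders and holds
  automatically for points outside \<open>\<rat>(i)\<close>.\<close>

definition hurwitz_digit :: "nat \<Rightarrow> complex \<Rightarrow> complex" where
  "hurwitz_digit n z = hurwitz_round (inverse ((hurwitz_map ^^ (n - 1)) z))"

definition hurwitz_cylinder :: "complex list \<Rightarrow> complex set" where
  "hurwitz_cylinder b = {z \<in> hurwitz_domain. \<forall>j\<in>{1..length b}.
     (hurwitz_map ^^ (j - 1)) z \<noteq> 0 \<and> hurwitz_digit j z = b ! (j - 1)}"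

definition regular_word :: "complex list \<Rightarrow> bool" where
  "regular_word b \<longleftrightarrow> interior (hurwitz_cylinder b) \<noteq> {}"

definition gaussian_rationals :: "complex set" where
  "gaussian_rationals = {z. Re z \<in> \<rat> \<and> Im z \<in> \<rat>}"

definition ergodic_measure :: "'a measure \<Rightarrow> ('a \<Rightarrow> 'a) \<Rightarrow> bool" where
  "ergodic_measure M T \<longleftrightarrow>
     T \<in> measurable M M \<and> distr M M T = M \<and>
     (\<forall>A\<in>sets M. T -` A \<inter> space M = A \<longrightarrow> measure M A = 0 \<or> measure M A = 1)"

text \<open>The properties that characterise the measure \<open>\<mu>\<^sub>H\<close> uniquely. \<open>M\<close> lives on the subspace
  \<open>hurwitz_domain\<close>, and equivalence with Lebesgue measure is mutual absolute continuity.\<close>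

definition hurwitz_measure :: "complex measure \<Rightarrow> bool" where
  "hurwitz_measure M \<longleftrightarrow>
     prob_space M \<and>
     sets M = sets (restrict_space borel hurwitz_domain) \<and>
     ergodic_measure M hurwitz_map \<and>
     absolutely_continuous M (restrict_space lborel hurwitz_domain) \<and>
     absolutely_continuous (restrict_space lborel hurwitz_domain) M"

definition hurwitz_normal :: "complex measure \<Rightarrow> complex set" where
  "hurwitz_normal M = {z \<in> hurwitz_domain - gaussian_rationals.
     \<forall>n\<ge>1. \<forall>b. length b = n \<and> regular_word b \<longrightarrow>
       (\<lambda>N. real (card {j \<in> {0..<N}. map (\<lambda>k. hurwitz_digit (j + k) z) [1..<n + 1] = b}) / real N)
         \<longlonglongrightarrow> measure M (hurwitz_cylinder b)}"

text \<open>The Borel hierarchy. Only finite levels \<open>\<xi> \<ge> 1\<close> are covered: the definition of a finite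
  level refers to smaller levels only, so that no infinite ordinals are needed. Level \<open>0\<close>
  is empty.\<close>

inductive borel_Sigma :: "nat \<Rightarrow> 'a::polish_space set \<Rightarrow> bool"
  and borel_Pi :: "nat \<Rightarrow> 'a::polish_space set \<Rightarrow> bool" where
  Sigma_open: "open A \<Longrightarrow> borel_Sigma 1 A"
| Sigma_Union: "1 < \<xi> \<Longrightarrow> (\<And>n::nat. 1 \<le> \<eta> n \<and> \<eta> n < \<xi>) \<Longrightarrow> (\<And>n. borel_Pi (\<eta> n) (A n)) \<Longrightarrow>
    borel_Sigma \<xi> (\<Union>n. A n)"
| Pi_compl: "borel_Sigma \<xi> A \<Longrightarrow> borel_Pi \<xi> (- A)"

end

theory Submission
  imports Defs
begin

text \<open>The boundary of the square \<open>F\<close> and its forward images under \<open>T\<close> lie on the half-integer lines and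
  the unit circles about Gaussian integers (\<open>arcs\<close>), a closed set mapped into itself by \<open>T\<close>. Normal
  points never meet it, and where the orbit avoids it the digits are locally constant, so normality
  is a \<open>\<Pi>\<^sup>0\<^sub>3\<close> condition.

  The digit \<open>3 + 3i\<close> (\<open>pivot\<close>) resets the expansion: its cylinder is connected and misses \<open>arcs\<close>, so
  every block of digits of an orbit that ends with it can be followed by anything. By Birkhoff's
  theorem there is a generic point \<open>x\<close>. At sparse positions \<open>s\<^sub>k\<close> in its expansion, each just after a
  pivot, insert \<open>s\<^sub>k div (y\<^sub>k + 1)\<close> further pivots. If \<open>y\<^sub>k \<rightarrow> \<infinity>\<close>, the insertions have density zero and the
  new point is normal; otherwise the pivot becomes too frequent. So the normal numbers pull back
  continuously to the set of sequences \<open>y \<rightarrow> \<infinity>\<close>, which a Baire category argument shows not to be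
  \<open>\<Sigma>\<^sup>0\<^sub>3\<close>.\<close>

section \<open>The invariant arcs\<close>

text \<open>Admissible digit words do not form a free shift: after some digits the image of a
  cylinder is only a piece of the square, cut out by unit circles, so admissible words cannot be
  concatenated at will. A block that ends with the pivot has the whole square as its image, which
  restores free concatenation. The length of an insertion is proportional to its position: at
  \<open>s k\<close> it adds a proportion of about \<open>1 / (y k + 1)\<close>, which tends to 0
  exactly if \<open>y k\<close> tends to infinity. Rapid growth of \<open>s\<close> makes all
  earlier insertions together negligible at \<open>s k\<close>. That the pivot has measure below 1
  is essential for the converse: only then do additional pivots shift its frequency.\<close>

definition gauss_ints :: "complex set" where
  "gauss_ints = {z. Re z \<in> \<int> \<and> Im z \<in> \<int>}"

definition closed_square :: "complex set" where
  "closed_square = {z. \<bar>Re z\<bar> \<le> 1/2 \<and> \<bar>Im z\<bar> \<le> 1/2}"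

definition open_square :: "complex set" where
  "open_square = {z. \<bar>Re z\<bar> < 1/2 \<and> \<bar>Im z\<bar> < 1/2}"

definition arcs :: "complex set" where
  "arcs = {w. Re w - 1/2 \<in> \<int> \<or> Im w - 1/2 \<in> \<int> \<or> (\<exists>g\<in>gauss_ints. cmod (w - g) = 1)}"

lemma gauss_ints_add: "a \<in> gauss_ints \<Longrightarrow> b \<in> gauss_ints \<Longrightarrow> a + b \<in> gauss_ints"
  and gauss_ints_diff: "a \<in> gauss_ints \<Longrightarrow> b \<in> gauss_ints \<Longrightarrow> a - b \<in> gauss_ints"
  and gauss_ints_mult: "a \<in> gauss_ints \<Longrightarrow> b \<in> gauss_ints \<Longrightarrow> a * b \<in> gauss_ints"
  by (auto simp: gauss_ints_def)

lemma gauss_ints_minus: "a \<in> gauss_ints \<Longrightarrow> - a \<in> gauss_ints"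
  by (auto simp: gauss_ints_def)

lemma hurwitz_round_gauss [simp]: "hurwitz_round z \<in> gauss_ints"
  by (simp add: hurwitz_round_def gauss_ints_def)

lemma hurwitz_round_add:
  assumes "a \<in> gauss_ints" "w \<in> hurwitz_domain"
  shows "hurwitz_round (a + w) = a"
proof -
  obtain m n where a: "a = Complex (of_int m) (of_int n)"
    using assms(1) by (auto simp: gauss_ints_def complex_eq_iff elim!: Ints_cases)
  show ?thesis
    using assms(2) by (auto simp: a hurwitz_round_def hurwitz_domain_def complex_eq_iff floor_eq_iff)
qed

lemma hurwitz_round_diff_domain: "z - hurwitz_round z \<in> hurwitz_domain"
proof -
  have *: "-1/2 \<le> x - of_int \<lfloor>x + 1/2\<rfloor> \<and> x - of_int \<lfloor>x + 1/2\<rfloor> < 1/2" for x :: real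
    by linarith
  show ?thesis using *[of "Re z"] *[of "Im z"] by (simp add: hurwitz_domain_def hurwitz_round_def)
qed

lemma hurwitz_map_domain: "hurwitz_map z \<in> hurwitz_domain"
proof (cases "z = 0")
  case True
  then show ?thesis by (simp add: hurwitz_map_def hurwitz_domain_def)
next
  case False
  then show ?thesis using hurwitz_round_diff_domain[of "inverse z"] by (simp add: hurwitz_map_def)
qed

lemma hurwitz_map_funpow_domain: "z \<in> hurwitz_domain \<Longrightarrow> (hurwitz_map ^^ j) z \<in> hurwitz_domain"
  by (cases j) (auto simp: hurwitz_map_domain)

lemma hurwitz_map_zero_funpow: "(hurwitz_map ^^ j) 0 = 0"
  by (induction j) (auto simp: hurwitz_map_def)

lemma open_square_subset_domain: "open_square \<subseteq> hurwitz_domain"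
  and domain_subset_closed_square: "hurwitz_domain \<subseteq> closed_square"
  and open_square_subset_closed: "open_square \<subseteq> closed_square"
  by (auto simp: open_square_def hurwitz_domain_def closed_square_def)

section \<open>Topology of the square and of the arcs\<close>

lemma open_open_square: "open open_square"
  unfolding open_square_def by (intro open_Collect_conj open_Collect_less continuous_intros)

lemma closed_closed_square: "closed closed_square"
  unfolding closed_square_def by (intro closed_Collect_conj closed_Collect_le continuous_intros)

lemma closed_square_norm_sq: "z \<in> closed_square \<Longrightarrow> (cmod z)\<^sup>2 \<le> 1/2"
proof -
  assume "z \<in> closed_square"
  then have "\<bar>Re z\<bar>\<^sup>2 \<le> (1/2)\<^sup>2" "\<bar>Im z\<bar>\<^sup>2 \<le> (1/2)\<^sup>2"
    by (intro power_mono; simp add: closed_square_def)+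
  then show ?thesis by (simp add: cmod_power2 power_divide)
qed

lemma closed_square_norm: "z \<in> closed_square \<Longrightarrow> cmod z \<le> 1"
  using closed_square_norm_sq[of z] by (rule power2_le_imp_le[OF order_trans]) auto

lemma compact_closed_square: "compact closed_square"
  unfolding compact_eq_bounded_closed bounded_iff
  using closed_closed_square closed_square_norm by blast

lemma connected_closed_square: "connected closed_square"
proof -
  have "closed_square = cbox (Complex (-1/2) (-1/2)) (Complex (1/2) (1/2))"
    by (auto simp: closed_square_def in_cbox_complex_iff abs_le_iff)
  then show ?thesis by (metis convex_connected convex_box(1))
qed

lemma zero_in_arcs: "0 \<in> arcs"
proof -
  have "1 \<in> gauss_ints" by (simp add: gauss_ints_def)
  then show ?thesis unfolding arcs_def by force
qed

lemma arcs_translate: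
  assumes "g \<in> gauss_ints"
  shows "g + w \<in> arcs \<longleftrightarrow> w \<in> arcs"
proof -
  have *: "g + w \<in> arcs" if g: "g \<in> gauss_ints" and w: "w \<in> arcs" for g w
  proof -
    consider "Re w - 1/2 \<in> \<int>" | "Im w - 1/2 \<in> \<int>" | h where "h \<in> gauss_ints" "cmod (w - h) = 1"
      using w by (auto simp: arcs_def)
    then show ?thesis
    proof cases
      case 1
      then have "Re g + (Re w - 1/2) \<in> \<int>" using g by (intro Ints_add) (auto simp: gauss_ints_def)
      then show ?thesis by (simp add: arcs_def algebra_simps)
    next
      case 2
      then have "Im g + (Im w - 1/2) \<in> \<int>" using g by (intro Ints_add) (auto simp: gauss_ints_def)
      then show ?thesis by (simp add: arcs_def algebra_simps)
    next
      case 3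
      then have "g + h \<in> gauss_ints" "cmod (g + w - (g + h)) = 1"
        using g by (auto intro: gauss_ints_add)
      then show ?thesis unfolding arcs_def by blast
    qed
  qed
  have "w \<in> arcs" if "g + w \<in> arcs"
    using *[OF gauss_ints_minus[OF assms] that] by simp
  then show ?thesis using *[OF assms] by blast
qed

lemma closed_arcs: "closed arcs"
proof -
  have gi: "closed gauss_ints"
  proof -
    have "gauss_ints = Re -` \<int> \<inter> Im -` \<int>" by (auto simp: gauss_ints_def)
    moreover have "closed (Re -` \<int>)" "closed (Im -` \<int>)"
      by (intro continuous_closed_vimage closed_Ints continuous_intros)+
    ultimately show ?thesis by (metis closed_Int)
  qed
  \<comment> \<open>The union of all unit circles is the sum of a closed lattice and a compact
    circle.\<close>
  have "closed (\<Union>x\<in>gauss_ints. \<Union>y\<in>sphere 0 1. {x + y})"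
    by (rule closed_compact_sums[OF gi compact_sphere])
  moreover have "closed ((\<lambda>w. Re w - 1/2) -` \<int>)" "closed ((\<lambda>w. Im w - 1/2) -` \<int>)"
    by (intro continuous_closed_vimage closed_Ints continuous_intros)+
  moreover have "arcs = (\<lambda>w. Re w - 1/2) -` \<int> \<union> (\<lambda>w. Im w - 1/2) -` \<int> \<union>
      (\<Union>x\<in>gauss_ints. \<Union>y\<in>sphere 0 1. {x + y})"
  proof -
    have "(\<exists>g\<in>gauss_ints. cmod (w - g) = 1) \<longleftrightarrow> w \<in> (\<Union>x\<in>gauss_ints. \<Union>y\<in>sphere 0 1. {x + y})" for w
    proof
      assume "\<exists>g\<in>gauss_ints. cmod (w - g) = 1"
      then obtain g where g: "g \<in> gauss_ints" "cmod (w - g) = 1" by auto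
      then have "w = g + (w - g)" "w - g \<in> sphere 0 1" by auto
      then show "w \<in> (\<Union>x\<in>gauss_ints. \<Union>y\<in>sphere 0 1. {x + y})" using g by blast
    next
      assume "w \<in> (\<Union>x\<in>gauss_ints. \<Union>y\<in>sphere 0 1. {x + y})"
      then obtain x y where "x \<in> gauss_ints" "cmod y = 1" "w = x + y" by auto
      then have "cmod (w - x) = 1" by simp
      then show "\<exists>g\<in>gauss_ints. cmod (w - g) = 1" using \<open>x \<in> gauss_ints\<close> by blast
    qed
    then show ?thesis unfolding arcs_def by blast
  qed
  ultimately show ?thesis by (metis closed_Un)
qed

lemma square_boundary_arcs: "w \<in> closed_square \<Longrightarrow> w \<notin> arcs \<Longrightarrow> w \<in> open_square"
proof -
  assume w: "w \<in> closed_square" "w \<notin> arcs"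
  have *: "x - 1/2 \<in> \<int>" if "\<bar>x\<bar> = 1/2" for x :: real
  proof -
    have "x - 1/2 = 0 \<or> x - 1/2 = -1" using that by linarith
    then show ?thesis by (metis Ints_0 Ints_1 Ints_minus)
  qed
  show ?thesis using w *[of "Re w"] *[of "Im w"]
    by (auto simp: closed_square_def open_square_def arcs_def less_le)
qed

text \<open>The family of lines and unit circles making up \<open>arcs\<close> is stable under inversion as far as it
  meets the square: the edges become the circles about \<open>\<plusminus>1, \<plusminus>i\<close>, these circles become
  edge lines, and the circles about \<open>\<plusminus>1\<plusminus>i\<close> are permuted.\<close>

lemma inverse_arcs_strong:
  assumes "w \<in> closed_square" "w \<in> arcs" "w \<noteq> 0"
  shows "inverse w \<in> arcs \<and> (Re (inverse w) \<le> 2 \<or> Im (inverse w) \<le> 2)"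
proof -
  define v where "v = inverse w"
  define p where "p = Re v"
  define q where "q = Im v"
  have v0: "v \<noteq> 0" and wv: "w = inverse v" using assms(3) by (auto simp: v_def)
  define N where "N = p\<^sup>2 + q\<^sup>2"
  have N: "N > 0" using v0 by (auto simp: N_def p_def q_def complex_eq_iff sum_power2_gt_zero_iff)
  have rew: "Re w = p / N" "Im w = - q / N" by (simp_all add: wv N_def p_def q_def)
  have half: "\<bar>Re w\<bar> \<le> 1/2" "\<bar>Im w\<bar> \<le> 1/2" using assms(1) by (auto simp: closed_square_def)
  have edge: "x = 1/2 \<or> x = -1/2" if x: "\<bar>x\<bar> \<le> 1/2" "x - 1/2 \<in> \<int>" for x :: real
  proof -
    obtain k where k: "x - 1/2 = of_int k" using x(2) by (rule Ints_cases)
    then have "-1 \<le> real_of_int k" "real_of_int k \<le> 0" using x by linarith+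
    then have "k = -1 \<or> k = 0" by linarith
    then show ?thesis using k by auto
  qed
  \<comment> \<open>All circles that arise have a centre with real part at most 1; this is the
    origin of the bound 2 in the conclusion.\<close>
  have circ: ?thesis if "(p - m)\<^sup>2 + (q - n)\<^sup>2 = 1" "m \<in> \<int>" "n \<in> \<int>" "m \<le> 1" for m n
  proof -
    have "Complex m n \<in> gauss_ints" using that by (auto simp: gauss_ints_def)
    moreover have "cmod (v - Complex m n) = 1" using that(1) by (simp add: cmod_def p_def q_def)
    ultimately have "v \<in> arcs" unfolding arcs_def by blast
    moreover have "(p - m)\<^sup>2 \<le> 1\<^sup>2" using that(1) by (smt (verit) one_power2 zero_le_power2)
    then have "p - m \<le> 1" by (rule power2_le_imp_le) auto
    then have "Re v \<le> 2" using that(4) by (simp add: p_def)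
    ultimately show ?thesis by (simp add: v_def)
  qed
  have line: ?thesis if "p = 1/2 \<or> p = -1/2 \<or> q = 1/2 \<or> q = -1/2"
  proof -
    have "p - 1/2 = 0 \<or> p - 1/2 = -1 \<or> q - 1/2 = 0 \<or> q - 1/2 = -1" using that by linarith
    moreover have "(0::real) \<in> \<int>" "(-1::real) \<in> \<int>" by simp_all
    ultimately have "p - 1/2 \<in> \<int> \<or> q - 1/2 \<in> \<int>" by metis
    then have "v \<in> arcs" unfolding arcs_def p_def q_def by blast
    moreover have "p \<le> 2 \<or> q \<le> 2" using that by linarith
    ultimately have "v \<in> arcs" "p \<le> 2 \<or> q \<le> 2" by blast+
    then show ?thesis by (simp add: v_def p_def q_def)
  qed
  consider "Re w - 1/2 \<in> \<int>" | "Im w - 1/2 \<in> \<int>" | g where "g \<in> gauss_ints" "cmod (w - g) = 1"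
    using assms(2) by (auto simp: arcs_def)
  then show ?thesis
  proof cases
    case 1
    then have "p / N = 1/2 \<or> p / N = -1/2" using edge[OF half(1)] rew by simp
    then have "N = 2 * p \<or> N = - 2 * p" using N by (auto simp: field_simps)
    then have "(p - 1)\<^sup>2 + (q - 0)\<^sup>2 = 1 \<or> (p - (-1))\<^sup>2 + (q - 0)\<^sup>2 = 1"
      by (auto simp: N_def power2_eq_square algebra_simps)
    then show ?thesis using circ[of 1 0] circ[of "-1" 0] by auto
  next
    case 2
    then have "- q / N = 1/2 \<or> - q / N = -1/2" using edge[OF half(2)] rew by simp
    then have "N = 2 * q \<or> N = - 2 * q" using N by (auto simp: field_simps)
    then have "(p - 0)\<^sup>2 + (q - 1)\<^sup>2 = 1 \<or> (p - 0)\<^sup>2 + (q - (-1))\<^sup>2 = 1"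
      by (auto simp: N_def power2_eq_square algebra_simps)
    then show ?thesis using circ[of 0 1] circ[of 0 "-1"] by auto
  next
    case 3
    obtain m n where g: "g = Complex (of_int m) (of_int n)"
      using 3(1) by (auto simp: gauss_ints_def complex_eq_iff elim!: Ints_cases)
    have "\<bar>Re (w - g)\<bar> \<le> 1" "\<bar>Im (w - g)\<bar> \<le> 1"
      using abs_Re_le_cmod[of "w - g"] abs_Im_le_cmod[of "w - g"] 3(2) by auto
    then have "\<bar>real_of_int m\<bar> < 2" "\<bar>real_of_int n\<bar> < 2" using half by (simp_all add: g)
    then have "\<bar>m\<bar> < 2" "\<bar>n\<bar> < 2" by linarith+
    then have "m = -1 \<or> m = 0 \<or> m = 1" "n = -1 \<or> n = 0 \<or> n = 1" by presburger+
    then have mn: "m \<in> {-1,0,1}" "n \<in> {-1,0,1}" by blast+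
    define M K where "M = real_of_int m" and "K = real_of_int n"
    have "(p / N - M)\<^sup>2 + (- q / N - K)\<^sup>2 = 1"
      using 3(2) by (simp add: cmod_def g rew M_def K_def)
    \<comment> \<open>Clearing denominators leaves a common factor \<open>N\<close>, because
      \<open>p\<^sup>2 + q\<^sup>2 = N\<close>. Cancelling it gives the inverted curve: a line if
      the centre has norm 1, a circle about the conjugate centre if both its coordinates are
      nonzero.\<close>
    then have "((p / N - M)\<^sup>2 + (- q / N - K)\<^sup>2) * N\<^sup>2 = N\<^sup>2" by simp
    moreover have "((p / N - M)\<^sup>2 + (- q / N - K)\<^sup>2) * N\<^sup>2 = (p - M * N)\<^sup>2 + (q + K * N)\<^sup>2"
      using N by (simp add: field_simps power2_eq_square)
    ultimately have "N * (1 - 2 * (M * p) + 2 * (K * q) + (M\<^sup>2 + K\<^sup>2) * N) = N * N"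
      by (simp add: power2_eq_square algebra_simps N_def)
    then have eq: "1 - 2 * (M * p) + 2 * (K * q) + (M\<^sup>2 + K\<^sup>2) * N = N"
      using N by simp
    have "\<not> (m = 0 \<and> n = 0)"
    proof
      assume "m = 0 \<and> n = 0"
      then have "cmod w = 1" using 3(2) by (simp add: g Complex_eq)
      then show False using closed_square_norm_sq[OF assms(1)] by simp
    qed
    then consider "n = 0" "m \<noteq> 0" | "m = 0" "n \<noteq> 0" | "m \<noteq> 0" "n \<noteq> 0" by blast
    then show ?thesis
    proof cases
      case 1
      then have M: "M = 1 \<or> M = -1" and K: "K = 0" using mn(1) by (auto simp: M_def K_def)
      then have T: "M\<^sup>2 + K\<^sup>2 = 1" by (elim disjE) (simp_all only: power2_minus one_power2 zero_power2 add_0_right)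
      have "K * q = 0" by (simp only: K mult_zero_left)
      then have "M * p = 1/2" using eq[unfolded T mult_1] by linarith
      then have "p = 1/2 \<or> p = -1/2" using M by (elim disjE) (hypsubst, linarith)+
      then show ?thesis by (intro line) blast
    next
      case 2
      then have M: "M = 0" and K: "K = 1 \<or> K = -1" using mn(2) by (auto simp: M_def K_def)
      then have T: "M\<^sup>2 + K\<^sup>2 = 1" by (elim disjE) (simp_all only: power2_minus one_power2 zero_power2 add_0_left)
      have "M * p = 0" by (simp only: M mult_zero_left)
      then have "K * q = -1/2" using eq[unfolded T mult_1] by linarith
      then have "q = 1/2 \<or> q = -1/2" using K by (elim disjE) (hypsubst, linarith)+
      then show ?thesis by (intro line) blast
    next
      case 3
      then have MK: "M\<^sup>2 = 1" "K\<^sup>2 = 1" "M \<le> 1" "M \<in> \<int>" "- K \<in> \<int>"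
        using mn by (auto simp: M_def K_def)
      have "(p - M)\<^sup>2 + (q - (- K))\<^sup>2 = N - 2 * (M * p) + 2 * (K * q) + M\<^sup>2 + K\<^sup>2"
        by (simp add: N_def power2_eq_square algebra_simps)
      also have "\<dots> = 1" using eq[unfolded MK(1,2) one_add_one] MK(1,2) by linarith
      finally show ?thesis using MK by (intro circ[of M "- K"])
    qed
  qed
qed

text \<open>With the convention \<open>inverse 0 = 0\<close> the point 0 causes no
  exception.\<close>

lemma inverse_arcs: "w \<in> closed_square \<Longrightarrow> w \<in> arcs \<Longrightarrow> inverse w \<in> arcs"
  using inverse_arcs_strong[of w] by (metis inverse_zero)

lemma hurwitz_map_arcs:
  assumes "z \<in> hurwitz_domain" "z \<in> arcs"
  shows "hurwitz_map z \<in> arcs"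
proof (cases "z = 0")
  case True
  then show ?thesis by (simp add: hurwitz_map_def zero_in_arcs)
next
  case False
  have "inverse z \<in> arcs" using assms domain_subset_closed_square inverse_arcs by blast
  then have "- hurwitz_round (inverse z) + inverse z \<in> arcs"
    by (subst arcs_translate) (auto intro: gauss_ints_minus)
  then show ?thesis using False by (simp add: hurwitz_map_def)
qed

text \<open>A connected set that misses \<open>arcs\<close> cannot leave the square when it is pulled back along an
  inverse branch of the Hurwitz map, because the boundary of the square lies on \<open>arcs\<close>.\<close>

lemma connected_pullback:
  assumes S: "connected S" "S \<inter> arcs = {}" and a: "a \<in> gauss_ints"
    and s: "s \<in> S" "inverse (a + s) \<in> closed_square"
  defines "S' \<equiv> (\<lambda>w. inverse (a + w)) ` S"
  shows "connected S'" "S' \<subseteq> open_square - arcs"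
proof -
  have av: "a + w \<notin> arcs" if "w \<in> S" for w using arcs_translate[OF a] S that by blast
  have nz: "a + w \<noteq> 0" if "w \<in> S" for w using av[OF that] zero_in_arcs by auto
  show con: "connected S'" unfolding S'_def
    by (intro connected_continuous_image S continuous_intros) (use nz in auto)
  have sq: "w \<notin> arcs" if "w \<in> S'" "w \<in> closed_square" for w
  proof
    assume "w \<in> arcs"
    then have "inverse w \<in> arcs" using inverse_arcs that by blast
    then show False using that av by (auto simp: S'_def)
  qed
  have "S' \<subseteq> open_square \<union> - closed_square"
    using sq square_boundary_arcs by blast
  then have "open_square \<inter> S' = {} \<or> - closed_square \<inter> S' = {}"
    using open_square_subset_closed
    by (intro connectedD[OF con]) (auto simp: open_open_square closed_closed_square)
  moreover have "inverse (a + s) \<in> open_square \<inter> S'"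
    using s sq[of "inverse (a + s)"] square_boundary_arcs by (auto simp: S'_def)
  ultimately show "S' \<subseteq> open_square - arcs"
    using \<open>S' \<subseteq> open_square \<union> - closed_square\<close> sq open_square_subset_closed by blast
qed

section \<open>The digit 3 + 3i\<close>

definition pivot :: complex where "pivot = Complex 3 3"

lemma pivot_gauss: "pivot \<in> gauss_ints" by (simp add: pivot_def gauss_ints_def)

text \<open>The square about \<open>3 + 3i\<close> has both coordinates at least \<open>5/2\<close>,
  while the inverse of a nonzero point of \<open>arcs\<close> in the square has a coordinate at most
  2. The digit \<open>2 + 2i\<close> would fail: its square is crossed by the unit circle about
  \<open>1 + i\<close>.\<close>

lemma pivot_branch:
  assumes "q \<in> closed_square"
  shows "inverse (pivot + q) \<in> open_square - arcs" "pivot + q \<noteq> 0"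
proof -
  let ?v = "pivot + q"
  have v: "Re ?v \<ge> 5/2" "Im ?v \<ge> 5/2" using assms by (auto simp: pivot_def closed_square_def)
  then show nz: "?v \<noteq> 0" by (auto simp: complex_eq_iff)
  have "cmod ?v \<ge> 5/2" using v(1) abs_Re_le_cmod[of ?v] by linarith
  then have "cmod (inverse ?v) \<le> 2/5" using le_imp_inverse_le[of "5/2" "cmod ?v"] by (simp add: norm_inverse)
  then have os: "inverse ?v \<in> open_square"
    using abs_Re_le_cmod[of "inverse ?v"] abs_Im_le_cmod[of "inverse ?v"]
    unfolding open_square_def mem_Collect_eq by linarith
  moreover have "inverse ?v \<notin> arcs"
  proof
    assume "inverse ?v \<in> arcs"
    then have "Re ?v \<le> 2 \<or> Im ?v \<le> 2"
      using inverse_arcs_strong[of "inverse ?v"] os open_square_subset_closed nz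
      by (metis inverse_inverse_eq inverse_nonzero_iff_nonzero subsetD)
    then show False using v by linarith
  qed
  ultimately show "inverse ?v \<in> open_square - arcs" by blast
qed

section \<open>Full words\<close>

text \<open>The finite continued fraction with partial quotients \<open>u\<close> and tail
  \<open>w\<close>; as a function of \<open>w\<close>, a formal inverse branch of an iterate of the
  Hurwitz map.\<close>

fun branch :: "complex list \<Rightarrow> complex \<Rightarrow> complex" where
  "branch [] w = w"
| "branch (a # u) w = inverse (a + branch u w)"

text \<open>The inclusion is demanded for every nonempty suffix, so that all intermediate iterates
  stay in the domain. The closed square provides compactness, and missing \<open>arcs\<close>
  excludes the pole 0 and permits further pullbacks.\<close>

fun full_word :: "complex list \<Rightarrow> bool" where
  "full_word [] \<longleftrightarrow> True"
| "full_word (a # u) \<longleftrightarrow>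
     a \<in> gauss_ints \<and> full_word u \<and> branch (a # u) ` closed_square \<subseteq> open_square - arcs"

lemma branch_append: "branch (u @ v) w = branch u (branch v w)"
  by (induction u) auto

lemma full_word_square: "full_word u \<Longrightarrow> q \<in> closed_square \<Longrightarrow> branch u q \<in> closed_square"
  using open_square_subset_closed by (cases u) (auto simp del: branch.simps simp: branch.simps(1))

lemma full_word_open:
  "full_word u \<Longrightarrow> u \<noteq> [] \<Longrightarrow> q \<in> closed_square \<Longrightarrow> branch u q \<in> open_square - arcs"
  by (cases u) (auto simp del: branch.simps)

lemma full_word_nonzero:
  "full_word (a # u) \<Longrightarrow> q \<in> closed_square \<Longrightarrow> branch (a # u) q \<noteq> 0 \<and> a + branch u q \<noteq> 0"
  using full_word_open[of "a # u" q] zero_in_arcs by auto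

text \<open>A full word accepts every point of the closed square as its tail, in particular the
  values of the branch of \<open>v\<close>.\<close>

lemma full_word_append: "full_word u \<Longrightarrow> full_word v \<Longrightarrow> full_word (u @ v)"
proof (induction u)
  case (Cons a u)
  have "branch (a # u @ v) q \<in> open_square - arcs" if "q \<in> closed_square" for q
    using full_word_open[OF Cons.prems(1) _ full_word_square[OF Cons.prems(2) that]]
    by (simp add: branch_append)
  then show ?case using Cons by (auto simp del: branch.simps)
qed simp

lemma full_word_appendD: "full_word (u @ v) \<Longrightarrow> full_word v"
  by (induction u) auto

lemma branch_continuous_on: "full_word u \<Longrightarrow> continuous_on closed_square (branch u)"
proof (induction u)
  case (Cons a u)
  then have "continuous_on closed_square (\<lambda>q. inverse (a + branch u q))"
    using full_word_nonzero[OF Cons.prems] by (intro continuous_intros) auto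
  then show ?case by (simp add: fun_eq_iff cong: continuous_on_cong)
qed simp

text \<open>Since \<open>branch u\<close> maps the square to a connected set off
  \<open>arcs\<close>, a further pullback stays in the square as soon as one of its points does. For
  the empty word this breaks down, as the square itself meets \<open>arcs\<close>.\<close>

lemma full_word_Cons:
  assumes "full_word u" "u \<noteq> []" "a \<in> gauss_ints" "q \<in> closed_square"
    and "branch (a # u) q \<in> closed_square"
  shows "full_word (a # u)"
proof -
  have "connected (branch u ` closed_square)"
    using assms(1) connected_closed_square branch_continuous_on connected_continuous_image by blast
  moreover have "branch u ` closed_square \<inter> arcs = {}"
    using full_word_open[OF assms(1,2)] by blast
  ultimately have "(\<lambda>w. inverse (a + w)) ` branch u ` closed_square \<subseteq> open_square - arcs"
    using assms(3,4,5) by (intro connected_pullback(2)[where s = "branch u q"]) auto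
  then show ?thesis using assms(1,3) by auto
qed

lemma full_word_pivot: "full_word [pivot]"
  using pivot_branch pivot_gauss by auto

lemma full_word_replicate_pivot: "full_word (replicate n pivot)"
proof (induction n)
  case (Suc n)
  then show ?case using full_word_append[OF full_word_pivot, of "replicate n pivot"] by simp
qed simp

section \<open>Digits of orbits and inverse branches\<close>

lemma inverse_eq_digit_plus_map: "z \<noteq> 0 \<Longrightarrow> inverse z = hurwitz_digit 1 z + hurwitz_map z"
  by (simp add: hurwitz_digit_def hurwitz_map_def)

lemma hurwitz_digit_Suc: "hurwitz_digit (Suc j) z = hurwitz_digit 1 ((hurwitz_map ^^ j) z)"
  by (simp add: hurwitz_digit_def)

lemma branch_digits:
  assumes "\<And>j. (hurwitz_map ^^ j) z \<noteq> 0"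
  shows "i \<le> n \<Longrightarrow> branch (map (\<lambda>j. hurwitz_digit (Suc j) z) [i..<n]) ((hurwitz_map ^^ n) z)
           = (hurwitz_map ^^ i) z"
proof (induction rule: inc_induct)
  case (step i)
  have "inverse ((hurwitz_map ^^ i) z) = hurwitz_digit (Suc i) z + (hurwitz_map ^^ Suc i) z"
    using inverse_eq_digit_plus_map[OF assms[of i]] by (simp only: hurwitz_digit_Suc[of i] funpow.simps comp_apply)
  then have "(hurwitz_map ^^ i) z = inverse (hurwitz_digit (Suc i) z + (hurwitz_map ^^ Suc i) z)"
    by (metis inverse_inverse_eq)
  then show ?case using step by (simp add: upt_conv_Cons)
qed simp

text \<open>This spares a classification of the admissible words.\<close>

lemma full_word_digits_pivot:
  assumes "z \<in> hurwitz_domain" "\<And>j. (hurwitz_map ^^ j) z \<noteq> 0"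
    and "hurwitz_digit (Suc n) z = pivot"
  shows "i \<le> n \<Longrightarrow> full_word (map (\<lambda>j. hurwitz_digit (Suc j) z) [i..<Suc n])"
proof (induction rule: inc_induct)
  case base
  then show ?case using full_word_pivot assms(3) by simp
next
  case (step i)
  have cs: "(hurwitz_map ^^ j) z \<in> closed_square" for j
    using hurwitz_map_funpow_domain[OF assms(1)] domain_subset_closed_square by blast
  \<comment> \<open>The orbit supplies the single test point: the tail after the pivot is mapped by
    the branch to the iterate of index \<open>i\<close>, which lies in the square.\<close>
  have "full_word (hurwitz_digit (Suc i) z # map (\<lambda>j. hurwitz_digit (Suc j) z) [Suc i..<Suc n])"
  proof (rule full_word_Cons[where q = "(hurwitz_map ^^ Suc n) z"])
    have "branch (map (\<lambda>j. hurwitz_digit (Suc j) z) [i..<Suc n]) ((hurwitz_map ^^ Suc n) z)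
        = (hurwitz_map ^^ i) z"
      using step by (intro branch_digits assms) auto
    then show "branch (hurwitz_digit (Suc i) z # map (\<lambda>j. hurwitz_digit (Suc j) z) [Suc i..<Suc n])
         ((hurwitz_map ^^ Suc n) z) \<in> closed_square"
      using cs[of i] step by (simp add: upt_conv_Cons del: upt_Suc)
  qed (use step cs[of "Suc n"] in \<open>auto simp: hurwitz_digit_def\<close>)
  then show ?case using step by (simp add: upt_conv_Cons)
qed

text \<open>Inversion multiplies the distance of two points by the norms of their inverses. These
  lie in the square, hence have norm at most \<open>sqrt (1/2)\<close>, and every digit halves
  distances.\<close>

lemma branch_contraction:
  assumes "full_word u" "q \<in> closed_square" "q' \<in> closed_square"
  shows "cmod (branch u q - branch u q') \<le> (1/2) ^ length u * cmod (q - q')"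
  using assms(1)
proof (induction u)
  case (Cons a u)
  let ?x = "a + branch u q" and ?y = "a + branch u q'"
  have nz: "?x \<noteq> 0" "?y \<noteq> 0" using full_word_nonzero[OF Cons.prems] assms by auto
  have half: "cmod (inverse v) \<le> sqrt (1/2)" if "inverse v \<in> closed_square" for v
    using closed_square_norm_sq[OF that] real_le_rsqrt by blast
  have xy: "cmod (inverse ?x) \<le> sqrt (1/2)" "cmod (inverse ?y) \<le> sqrt (1/2)"
    using full_word_square[OF Cons.prems] assms(2,3) half by auto
  have "cmod (inverse ?x - inverse ?y) = cmod (inverse ?x) * cmod (?x - ?y) * cmod (inverse ?y)"
    using nz by (simp add: inverse_diff_inverse norm_mult)
  also have "\<dots> \<le> sqrt (1/2) * cmod (?x - ?y) * sqrt (1/2)"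
    using xy by (intro mult_mono mult_nonneg_nonneg) auto
  also have "\<dots> = 1/2 * cmod (branch u q - branch u q')"
    using real_sqrt_mult_self[of "1/2"] by (simp add: mult.commute mult.left_commute)
  also have "\<dots> \<le> 1/2 * ((1/2) ^ length u * cmod (q - q'))"
    using Cons by auto
  finally show ?case by simp
qed simp

text \<open>The last letter of \<open>u\<close> is left out in the second claim: the tail
  \<open>q\<close> may lie on the boundary of the closed square, where rounding can give a different
  digit. Before the last letter, the tail is a value of a nonempty full word and hence
  interior.\<close>

lemma hurwitz_map_branch:
  assumes "full_word u" "q \<in> closed_square"
  shows "i < length u \<Longrightarrow> (hurwitz_map ^^ i) (branch u q) = branch (drop i u) q"
    and "Suc i < length u \<Longrightarrow> hurwitz_digit (Suc i) (branch u q) = u ! i"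
proof -
  have step: "hurwitz_digit 1 (branch v q) = hd v \<and> hurwitz_map (branch v q) = branch (tl v) q"
    if v: "full_word v" "1 < length v" for v
  proof -
    obtain a w where aw: "v = a # w" "w \<noteq> []" using v(2) by (cases v) auto
    have nz: "branch v q \<noteq> 0" using full_word_nonzero v(1) assms(2) by (simp add: aw(1))
    have "branch w q \<in> hurwitz_domain"
      using full_word_open[of w q] v(1) aw assms(2) open_square_subset_domain by auto
    then have "hurwitz_round (a + branch w q) = a"
      using v(1) aw by (intro hurwitz_round_add) auto
    then show ?thesis using nz aw(1) by (simp add: hurwitz_digit_def hurwitz_map_def)
  qed
  have suff: "full_word (drop i u)" for i
    using full_word_appendD[of "take i u" "drop i u"] assms(1) by simp
  have iter: "i < length u \<Longrightarrow> (hurwitz_map ^^ i) (branch u q) = branch (drop i u) q" for i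
  proof (induction i)
    case (Suc i)
    then have "(hurwitz_map ^^ Suc i) (branch u q) = hurwitz_map (branch (drop i u) q)" by simp
    also have "\<dots> = branch (tl (drop i u)) q" using Suc step[OF suff[of i]] by auto
    finally show ?case by (simp add: drop_Suc tl_drop)
  qed simp
  then show "i < length u \<Longrightarrow> (hurwitz_map ^^ i) (branch u q) = branch (drop i u) q" .
  show "hurwitz_digit (Suc i) (branch u q) = u ! i" if "Suc i < length u"
  proof -
    have "hurwitz_digit (Suc i) (branch u q) = hurwitz_digit 1 (branch (drop i u) q)"
      using iter[of i] that by (simp only: hurwitz_digit_Suc[of i] Suc_lessD)
    also have "\<dots> = hd (drop i u)" using step[OF suff[of i]] that by auto
    finally show ?thesis using that by (simp add: hd_drop_conv_nth)
  qed
qed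

text \<open>The branch images of the closed square are nested compact sets. Since the words grow,
  every digit of a common point is eventually read at a position before the last letter.\<close>

lemma full_words_point:
  fixes W :: "nat \<Rightarrow> complex list"
  assumes "\<And>k. full_word (W k)" and "\<And>k. \<exists>v. v \<noteq> [] \<and> W (Suc k) = W k @ v"
  obtains z where "z \<in> open_square" "\<And>k. z \<in> branch (W k) ` closed_square"
    "\<And>j. (hurwitz_map ^^ j) z \<noteq> 0"
    "\<And>k j. Suc j < length (W k) \<Longrightarrow> hurwitz_digit (Suc j) z = W k ! j"
proof -
  let ?K = "\<lambda>k. branch (W k) ` closed_square"
  have dec: "?K (Suc k) \<subseteq> ?K k" for k
  proof -
    obtain v where v: "W (Suc k) = W k @ v" using assms(2) by blast
    then have "full_word v" using assms(1)[of "Suc k"] full_word_appendD by simp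
    then show ?thesis using v full_word_square by (auto simp: branch_append)
  qed
  have len: "k \<le> length (W k)" for k
  proof (induction k)
    case (Suc k)
    obtain v where "v \<noteq> []" "W (Suc k) = W k @ v" using assms(2) by blast
    then show ?case using Suc by (cases v) auto
  qed simp
  have "\<Inter> (range ?K) \<noteq> {}"
  proof (rule compact_nest)
    show "compact (?K k)" for k
      using assms(1) branch_continuous_on compact_continuous_image compact_closed_square by blast
    show "?K k \<noteq> {}" for k by (auto simp: closed_square_def intro!: exI[of _ 0])
    show "?K n \<subseteq> ?K m" if "m \<le> n" for m n
      using that by (induction rule: dec_induct) (use dec in blast)+
  qed
  then obtain z where z: "\<And>k. z \<in> ?K k" by blast
  show thesis
  proof
    have op: "(hurwitz_map ^^ j) z \<in> open_square - arcs" if "j < length (W k)" for j k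
    proof -
      obtain q where q: "q \<in> closed_square" "z = branch (W k) q" using z by blast
      then have "(hurwitz_map ^^ j) z = branch (drop j (W k)) q"
        using hurwitz_map_branch(1)[OF assms(1)] that by blast
      moreover have "full_word (drop j (W k))"
        using full_word_appendD[of "take j (W k)" "drop j (W k)"] assms(1) by simp
      ultimately show ?thesis using full_word_open q(1) that by simp
    qed
    show "z \<in> open_square" using op[of 0 1] len[of 1] by force
    show "(hurwitz_map ^^ j) z \<noteq> 0" for j
      using op[of j "Suc j"] len[of "Suc j"] zero_in_arcs by force
    show "hurwitz_digit (Suc j) z = W k ! j" if "Suc j < length (W k)" for j k
    proof -
      obtain q where q: "q \<in> closed_square" "z = branch (W k) q" using z by blast
      then show ?thesis using hurwitz_map_branch(2)[OF assms(1)] that by blast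
    qed
  qed (use z in blast)
qed

text \<open>The Hurwitz map replaces the denominator of a Gaussian rational by its numerator, which has
  smaller norm.\<close>

lemma gaussian_rational_orbit_zero:
  assumes "z \<in> hurwitz_domain" "z \<in> gaussian_rationals"
  shows "\<exists>j. (hurwitz_map ^^ j) z = 0"
proof -
  have desc: "\<exists>j. (hurwitz_map ^^ j) (p / q) = 0"
    if "p \<in> gauss_ints" "q \<in> gauss_ints" "q \<noteq> 0" "p / q \<in> hurwitz_domain" for p q
    using that
  \<comment> \<open>The squared norm of a Gaussian integer is an integer; \<open>nat\<close> and the
    floor merely turn it into an induction measure.\<close>
  proof (induction "nat \<lfloor>(cmod q)\<^sup>2\<rfloor>" arbitrary: p q rule: less_induct)
    case less
    show ?case
    proof (cases "p = 0")
      case True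
      then show ?thesis by (intro exI[of _ 0]) simp
    next
      case False
      define a where "a = hurwitz_round (q / p)"
      have sq: "(cmod g)\<^sup>2 \<in> \<int>" if "g \<in> gauss_ints" for g
        using that by (auto simp: cmod_power2 gauss_ints_def)
      have "(cmod (p / q))\<^sup>2 < 1"
        using closed_square_norm_sq[of "p / q"] less.prems(4) domain_subset_closed_square by fastforce
      then have lt: "(cmod p)\<^sup>2 < (cmod q)\<^sup>2"
        using less.prems(3) by (simp add: norm_divide power_divide divide_less_eq)
      obtain m n where mn: "(cmod p)\<^sup>2 = of_int m" "(cmod q)\<^sup>2 = of_int n"
        using sq less.prems(1,2) by (metis Ints_cases)
      have "nat \<lfloor>(cmod p)\<^sup>2\<rfloor> < nat \<lfloor>(cmod q)\<^sup>2\<rfloor>"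
      proof -
        have "0 \<le> m" using mn(1) by (metis of_int_0_le_iff zero_le_power2)
        moreover have "m < n" using lt mn by simp
        ultimately show ?thesis by (simp add: mn)
      qed
      moreover have eq: "hurwitz_map (p / q) = (q - a * p) / p"
        using False less.prems(3) by (simp add: hurwitz_map_def a_def diff_divide_distrib)
      moreover have "q - a * p \<in> gauss_ints"
        using less.prems(1,2) by (intro gauss_ints_diff gauss_ints_mult) (auto simp: a_def)
      ultimately obtain j where "(hurwitz_map ^^ j) ((q - a * p) / p) = 0"
        using less.hyps[of p "q - a * p"] less.prems False hurwitz_map_domain by metis
      then have "(hurwitz_map ^^ Suc j) (p / q) = 0" by (simp add: funpow_Suc_right eq del: funpow.simps)
      then show ?thesis by blast
    qed
  qed
  obtain a b where ab: "Re z = of_int a / of_int b" "b \<noteq> 0"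
    using assms(2) by (auto simp: gaussian_rationals_def elim!: Rats_cases')
  obtain c d where cd: "Im z = of_int c / of_int d" "d \<noteq> 0"
    using assms(2) by (auto simp: gaussian_rationals_def elim!: Rats_cases')
  define p where "p = Complex (of_int (a * d)) (of_int (c * b))"
  define q :: complex where "q = of_int (b * d)"
  have "z * q = p" using ab(2) cd(2) by (simp add: complex_eq_iff p_def q_def ab(1) cd(1))
  moreover have "q \<noteq> 0" using ab(2) cd(2) by (simp add: q_def)
  ultimately have "z = p / q" by (simp add: field_simps)
  moreover have "p \<in> gauss_ints" "q \<in> gauss_ints" by (auto simp: p_def q_def gauss_ints_def)
  ultimately show ?thesis using desc[of p q] \<open>q \<noteq> 0\<close> assms(1) by simp
qed

section \<open>The ergodic theorem for indicator functions\<close>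

text \<open>The maximum of the Birkhoff sums of length at most \<open>N\<close>, in the recursive form from which
  Garsia's proof of the maximal ergodic inequality can be read off.\<close>

primrec max_sum :: "('a \<Rightarrow> 'a) \<Rightarrow> ('a \<Rightarrow> real) \<Rightarrow> nat \<Rightarrow> 'a \<Rightarrow> real" where
  "max_sum T f 0 x = 0"
| "max_sum T f (Suc N) x = max 0 (f x + max_sum T f N (T x))"

lemma max_sum_nonneg: "0 \<le> max_sum T f N x"
  by (cases N) auto

lemma max_sum_mono: "max_sum T f N x \<le> max_sum T f (Suc N) x"
proof (induction N arbitrary: x)
  case (Suc N)
  have "max 0 (f x + max_sum T f N (T x)) \<le> max 0 (f x + max_sum T f (Suc N) (T x))"
    using Suc[of "T x"] by (intro max.mono) auto
  then show ?case by simp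
qed (simp add: max_sum_nonneg)

lemma birkhoff_sum_Suc:
  fixes f :: "'a \<Rightarrow> real"
  shows "(\<Sum>j<Suc n. f ((T ^^ j) x)) = f x + (\<Sum>j<n. f ((T ^^ j) (T x)))"
  by (simp only: sum.lessThan_Suc_shift funpow_Suc_right comp_apply funpow_0)

lemma birkhoff_sum_le_max_sum: "(\<Sum>j<n. f ((T ^^ j) x)) \<le> max_sum T f n x"
proof (induction n arbitrary: x)
  case (Suc n)
  have "(\<Sum>j<Suc n. f ((T ^^ j) x)) = f x + (\<Sum>j<n. f ((T ^^ j) (T x)))"
    by (rule birkhoff_sum_Suc)
  then show ?case using Suc[of "T x"] by simp
qed simp

lemma max_sum_bound:
  assumes "\<And>x. \<bar>f x\<bar> \<le> B"
  shows "max_sum T f N x \<le> real N * B"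
proof (induction N arbitrary: x)
  case (Suc N)
  have "0 \<le> B" using assms[of x] by linarith
  moreover have "f x \<le> B" using assms[of x] by linarith
  ultimately show ?case using Suc[of "T x"] by (auto simp: algebra_simps)
qed simp

lemma max_sum_measurable [measurable]:
  assumes [measurable]: "T \<in> measurable M M" "f \<in> borel_measurable M"
  shows "max_sum T f N \<in> borel_measurable M"
proof (induction N)
  case (Suc N)
  then have [measurable]: "max_sum T f N \<in> borel_measurable M" .
  have "(\<lambda>x. max 0 (f x + max_sum T f N (T x))) \<in> borel_measurable M" by measurable
  then show ?case by (simp cong: measurable_cong)
qed (simp add: max_sum.simps(1)[abs_def])

text \<open>Where the maximum \<open>g (Suc N)\<close> is positive, it equals
  \<open>f + g N \<circ> T\<close>; elsewhere it is 0 and \<open>g N \<circ> T\<close> is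
  nonnegative. So \<open>g (Suc N) - g N \<circ> T\<close> is a lower bound of the integrand, and
  its integral is nonnegative by invariance and monotonicity in \<open>N\<close>.\<close>

lemma maximal_ergodic_inequality:
  assumes "finite_measure M" and T [measurable]: "T \<in> measurable M M" and inv: "distr M M T = M"
    and f [measurable]: "f \<in> borel_measurable M" and B: "\<And>x. \<bar>f x\<bar> \<le> B"
  shows "0 \<le> (\<integral>x. f x * indicator {x. max_sum T f (Suc N) x > 0} x \<partial>M)"
proof -
  interpret finite_measure M by fact
  define g where "g = max_sum T f"
  have [measurable]: "g n \<in> borel_measurable M" for n by (simp add: g_def)
  have bound: "\<bar>g n x\<bar> \<le> real n * B" for n x
    using max_sum_bound[of f B T n x, OF B] max_sum_nonneg[of T f n x] by (simp add: g_def)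
  have int: "integrable M (g n)" for n
    using bound by (intro integrable_const_bound[of _ "real n * B"]) auto
  have intT: "integrable M (\<lambda>x. g n (T x))" for n
    using bound by (intro integrable_const_bound[of _ "real n * B"]) auto
  have "(\<integral>x. g N x \<partial>M) = (\<integral>x. g N x \<partial>distr M M T)" by (simp add: inv)
  also have "\<dots> = (\<integral>x. g N (T x) \<partial>M)" by (intro integral_distr) auto
  finally have eqT: "(\<integral>x. g N (T x) \<partial>M) = (\<integral>x. g N x \<partial>M)" ..
  have "0 \<le> (\<integral>x. g (Suc N) x \<partial>M) - (\<integral>x. g N (T x) \<partial>M)"
  proof -
    have "(\<integral>x. g N x \<partial>M) \<le> (\<integral>x. g (Suc N) x \<partial>M)"
      by (intro integral_mono int) (simp only: g_def max_sum_mono)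
    then show ?thesis by (simp add: eqT)
  qed
  also have "\<dots> = (\<integral>x. g (Suc N) x - g N (T x) \<partial>M)"
    using int intT by (intro Bochner_Integration.integral_diff[symmetric]) auto
  also have "\<dots> \<le> (\<integral>x. f x * indicator {x. g (Suc N) x > 0} x \<partial>M)"
  proof (rule integral_mono)
    show "integrable M (\<lambda>x. g (Suc N) x - g N (T x))"
      using int intT by (intro Bochner_Integration.integrable_diff) auto
    have [measurable]: "Measurable.pred M (\<lambda>x. g (Suc N) x > 0)" by measurable
    have "(\<lambda>x. f x * (if g (Suc N) x > 0 then 1 else 0)) \<in> borel_measurable M" by measurable
    then have [measurable]: "(\<lambda>x. f x * indicator {x. g (Suc N) x > 0} x) \<in> borel_measurable M"
      by (simp add: indicator_def)
    show "integrable M (\<lambda>x. f x * indicator {x. g (Suc N) x > 0} x)"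
    proof (intro integrable_const_bound[of _ B] AE_I2)
      fix x
      show "norm (f x * indicator {x. g (Suc N) x > 0} x) \<le> B"
        using B[of x] by (auto simp: indicator_def)
    qed measurable
    show "g (Suc N) x - g N (T x) \<le> f x * indicator {x. g (Suc N) x > 0} x" for x
      using max_sum_nonneg[of T f N "T x"] by (auto simp: g_def indicator_def)
  qed
  finally show ?thesis by (simp add: g_def)
qed

text \<open>The set of points with sums unbounded above is invariant, hence has measure 0 or 1. If
  it had measure 1, the sets in the maximal inequality would exhaust the space almost surely, and
  the integral of \<open>f\<close> would be nonnegative in the limit.\<close>

lemma ergodic_birkhoff_bounded_above:
  assumes "prob_space M" "ergodic_measure M T"
    and f [measurable]: "f \<in> borel_measurable M" and B: "\<And>x. \<bar>f x\<bar> \<le> B"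
    and neg: "(\<integral>x. f x \<partial>M) < 0"
  shows "AE x in M. \<exists>k::nat. \<forall>n. (\<Sum>j<n. f ((T ^^ j) x)) \<le> real k"
proof -
  interpret prob_space M by fact
  have T [measurable]: "T \<in> measurable M M" and inv: "distr M M T = M"
    and erg: "\<And>A. A \<in> sets M \<Longrightarrow> T -` A \<inter> space M = A \<Longrightarrow> measure M A = 0 \<or> measure M A = 1"
    using assms(2) by (auto simp: ergodic_measure_def)
  define S where "S n x = (\<Sum>j<n. f ((T ^^ j) x))" for n x
  have [measurable]: "(T ^^ j) \<in> measurable M M" for j
    by (induction j) auto
  have [measurable]: "S n \<in> borel_measurable M" for n
    unfolding S_def by measurable
  define U where "U = {x \<in> space M. \<forall>k::nat. \<exists>n. S n x > real k}"
  have U [measurable]: "U \<in> sets M" unfolding U_def by measurable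
  have S_Suc: "S (Suc n) x = f x + S n (T x)" for n x
    unfolding S_def by (rule birkhoff_sum_Suc)
  \<comment> \<open>The sums at \<open>x\<close> and at \<open>T x\<close> differ by one shift of
    the length and one term bounded by \<open>B\<close>, which is absorbed by enlarging the
    threshold.\<close>
  have "T x \<in> U \<longleftrightarrow> x \<in> U" if x: "x \<in> space M" for x
  proof -
    have Tx: "T x \<in> space M" using x measurable_space[OF T] by blast
    have "\<exists>n. S n x > real k" if *: "\<And>k::nat. \<exists>n. S n (T x) > real k" for k :: nat
    proof -
      obtain m :: nat where m: "real m > real k + B" using reals_Archimedean2 by blast
      obtain n where "S n (T x) > real m" using * by blast
      then have "S (Suc n) x > real k" using m B[of x] by (simp add: S_Suc)
      then show ?thesis by blast
    qed
    moreover have "\<exists>n. S n (T x) > real k" if *: "\<And>k::nat. \<exists>n. S n x > real k" for k :: nat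
    proof -
      obtain m :: nat where m: "real m > real k + B" using reals_Archimedean2 by blast
      obtain n where n: "S n x > real m" using * by blast
      have "n \<noteq> 0"
      proof
        assume "n = 0"
        then show False using n by (simp add: S_def)
      qed
      then obtain n' where "n = Suc n'" by (cases n) auto
      then have "S n' (T x) > real k" using n m B[of x] by (simp add: S_Suc)
      then show ?thesis by blast
    qed
    ultimately show ?thesis using x Tx by (auto simp: U_def)
  qed
  then have "T -` U \<inter> space M = U" by (auto simp: U_def)
  then consider "measure M U = 0" | "measure M U = 1" using erg[OF U] by blast
  then show ?thesis
  proof cases
    case 1
    then have "AE x in M. x \<notin> U"
      using U by (intro AE_not_in) (simp add: null_sets_def emeasure_eq_measure)
    with AE_space show ?thesis by eventually_elim (auto simp: U_def S_def not_less)
  next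
    case 2
    define h where "h N x = f x * indicator {x. max_sum T f (Suc N) x > 0} x" for N x
    have AE: "AE x in M. x \<in> U" using 2 U by (simp add: prob_eq_1)
    have conv: "(\<lambda>N. h N x) \<longlonglongrightarrow> f x" if "x \<in> U" for x
    proof -
      obtain n where "S n x > 0" using \<open>x \<in> U\<close> by (auto simp: U_def dest: spec[of _ 0])
      then have pos: "max_sum T f n x > 0" using birkhoff_sum_le_max_sum[of f T x n] by (simp add: S_def)
      have "max_sum T f (Suc N) x > 0" if "n \<le> N" for N
        using lift_Suc_mono_le[of "\<lambda>N. max_sum T f N x", OF max_sum_mono, of n "Suc N"] that pos
        by linarith
      then have "eventually (\<lambda>N. h N x = f x) sequentially"
        by (intro eventually_sequentiallyI[of n]) (simp add: h_def)
      then show ?thesis by (rule tendsto_eventually)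
    qed
    have [measurable]: "h N \<in> borel_measurable M" for N
    proof -
      have [measurable]: "max_sum T f (Suc N) \<in> borel_measurable M" by (rule max_sum_measurable) auto
      have "(\<lambda>x. f x * (if max_sum T f (Suc N) x > 0 then 1 else 0)) \<in> borel_measurable M" by measurable
      then show ?thesis by (simp add: h_def[abs_def] indicator_def)
    qed
    have "(\<lambda>N. \<integral>x. h N x \<partial>M) \<longlonglongrightarrow> (\<integral>x. f x \<partial>M)"
    proof (rule integral_dominated_convergence[where w = "\<lambda>_. B"])
      show "AE x in M. (\<lambda>N. h N x) \<longlonglongrightarrow> f x" using AE by eventually_elim (rule conv)
      show "AE x in M. norm (h N x) \<le> B" for N
      proof (intro AE_I2)
        fix x
        show "norm (h N x) \<le> B" using B[of x] by (auto simp: h_def indicator_def)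
      qed
    qed auto
    moreover have "0 \<le> (\<integral>x. h N x \<partial>M)" for N
      unfolding h_def by (rule maximal_ergodic_inequality[OF finite_measure_axioms T inv f B])
    ultimately have "0 \<le> (\<integral>x. f x \<partial>M)" by (intro LIMSEQ_le_const) auto
    then show ?thesis using neg by linarith
  qed
qed

text \<open>The functions \<open>1_A - p - e\<close> and \<open>p - e - 1_A\<close> both have
  integral \<open>-e\<close>. Boundedness of their sums from above confines the count to a strip of
  slope \<open>e\<close> about \<open>p * n\<close>.\<close>

lemma birkhoff_indicator:
  assumes "prob_space M" "ergodic_measure M T" and A [measurable]: "A \<in> sets M"
  shows "AE x in M. (\<lambda>n. real (card {j \<in> {0..<n}. (T ^^ j) x \<in> A}) / real n) \<longlonglongrightarrow> measure M A"
proof -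
  interpret prob_space M by fact
  define c where "c n x = real (card {j \<in> {0..<n}. (T ^^ j) x \<in> A})" for n x
  define p where "p = measure M A"
  have c_sum: "c n x = (\<Sum>j<n. indicator A ((T ^^ j) x))" for n x
  proof -
    have "{j \<in> {0..<n}. (T ^^ j) x \<in> A} = {..<n} \<inter> {j. (T ^^ j) x \<in> A}" by auto
    then show ?thesis by (simp add: c_def indicator_def sum.If_cases)
  qed
  have iA: "integrable M (indicat_real A)"
    by (intro integrable_real_indicator) (auto simp: emeasure_eq_measure)
  have p01: "0 \<le> p" "p \<le> 1" by (simp_all add: p_def)
  have *: "AE x in M. \<exists>k::nat. \<forall>n. \<bar>c n x - p * n\<bar> \<le> e * n + k" if e: "0 < e" "e \<le> 1" for e :: real
  proof -
    let ?f = "\<lambda>x. indicator A x - p - e" and ?g = "\<lambda>x. p - e - indicator A x"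
    have "AE x in M. \<exists>k::nat. \<forall>n. (\<Sum>j<n. ?f ((T ^^ j) x)) \<le> real k"
    proof (rule ergodic_birkhoff_bounded_above[OF assms(1,2), where B = 3])
      show "\<bar>?f x\<bar> \<le> 3" for x using e p01 by (auto simp: indicator_def)
      show "(\<integral>x. ?f x \<partial>M) < 0" using e iA by (simp add: p_def prob_space)
    qed measurable
    moreover have "AE x in M. \<exists>k::nat. \<forall>n. (\<Sum>j<n. ?g ((T ^^ j) x)) \<le> real k"
    proof (rule ergodic_birkhoff_bounded_above[OF assms(1,2), where B = 3])
      show "\<bar>?g x\<bar> \<le> 3" for x using e p01 by (auto simp: indicator_def)
      show "(\<integral>x. ?g x \<partial>M) < 0" using e iA by (simp add: p_def prob_space)
    qed measurable
    ultimately show ?thesis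
    proof eventually_elim
      case (elim x)
      obtain k l :: nat where kl: "\<And>n. (\<Sum>j<n. ?f ((T ^^ j) x)) \<le> real k"
        "\<And>n. (\<Sum>j<n. ?g ((T ^^ j) x)) \<le> real l" using elim by blast
      have "(\<Sum>j<n. ?f ((T ^^ j) x)) = c n x - p * n - e * n"
        "(\<Sum>j<n. ?g ((T ^^ j) x)) = p * n - e * n - c n x" for n
        by (simp_all add: c_sum sum_subtractf sum.distrib algebra_simps)
      then have "\<bar>c n x - p * n\<bar> \<le> e * n + real (k + l)" for n
        using kl[of n] by (simp add: abs_le_iff)
      then show ?case by blast
    qed
  qed
  \<comment> \<open>Only countably many slopes are taken, so that the exceptional null sets can be
    united.\<close>
  have "AE x in M. \<forall>i::nat. \<exists>k::nat. \<forall>n. \<bar>c n x - p * n\<bar> \<le> 1 / (real i + 1) * n + k"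
    by (subst AE_all_countable, intro allI *) auto
  then show ?thesis
  proof eventually_elim
    case (elim x)
    have "(\<lambda>n. c n x / real n) \<longlonglongrightarrow> p"
    proof (rule LIMSEQ_I)
      fix r :: real assume r: "0 < r"
      obtain i where i: "1 / (real i + 1) < r / 2"
        using reals_Archimedean[of "r / 2"] r by (auto simp: inverse_eq_divide add.commute)
      obtain k where k: "\<And>n. \<bar>c n x - p * n\<bar> \<le> 1 / (real i + 1) * n + real k" using elim by blast
      obtain m :: nat where m: "2 * real k / r < real m" using reals_Archimedean2 by blast
      show "\<exists>no. \<forall>n\<ge>no. norm (c n x / real n - p) < r"
      proof (intro exI[of _ "Suc m"] allI impI)
        fix n assume n: "Suc m \<le> n"
        then have n0: "real n > 0" and "2 * real k / r < real n" using m by auto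
        then have "real k < r / 2 * real n" using r by (simp add: field_simps)
        moreover have "1 / (real i + 1) * n < r / 2 * n" using i n0 by (intro mult_strict_right_mono)
        ultimately have "\<bar>c n x - p * n\<bar> < r * n" using k[of n] by linarith
        moreover have "c n x / real n - p = (c n x - p * n) / n" using n0 by (simp add: field_simps)
        ultimately show "norm (c n x / real n - p) < r" using n0 by (simp add: pos_divide_less_eq)
      qed
    qed
    then show ?case by (simp add: c_def p_def)
  qed
qed

section \<open>Frequencies under sparse insertions\<close>

definition occurrences :: "(nat \<Rightarrow> 'a) \<Rightarrow> 'a list \<Rightarrow> nat \<Rightarrow> nat set" where
  "occurrences a b N = {j \<in> {0..<N}. map (\<lambda>k. a (j + k)) [0..<length b] = b}"

lemma finite_occurrences [simp]: "finite (occurrences a b N)"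
  by (simp add: occurrences_def)

text \<open>The sequence \<open>e\<close> arises from \<open>a\<close> by inserting \<open>D i\<close> letters in front of \<open>a i\<close> in total. The
  number \<open>N\<close> counts the letters of \<open>a\<close> among the first \<open>M\<close> letters of \<open>e\<close>.\<close>

lemma occurrences_insertion:
  fixes D :: "nat \<Rightarrow> nat"
  assumes "mono D" and ea: "\<And>i. e (i + D i) = a i"
    and N: "\<And>i. i < N \<Longrightarrow> i + D i < M" "M \<le> N + D N"
  shows "N \<le> M"
    "\<bar>real (card (occurrences e b M)) - real (card (occurrences a b N))\<bar>
       \<le> (real (length b) + 1) * real (D (N + length b))"
proof -
  define n where "n = length b"
  define \<iota> where "\<iota> i = i + D i" for i
  \<comment> \<open>Starting positions whose window may be torn apart in \<open>e\<close> by an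
    insertion.\<close>
  define Bad where "Bad = {i \<in> {..<N}. D (i + n) \<noteq> D i}"
  have mono: "i \<le> j \<Longrightarrow> D i \<le> D j" for i j using assms(1) by (simp add: mono_def)
  have inj: "inj \<iota>"
  proof (rule strict_mono_imp_inj_on[of \<iota>])
    show "strict_mono \<iota>" using mono by (auto simp: strict_mono_def \<iota>_def intro: add_less_le_mono)
  qed
  have sub: "\<iota> ` {..<N} \<subseteq> {..<M}" using N by (auto simp: \<iota>_def)
  have cN: "card (\<iota> ` {..<N}) = N" using inj by (simp add: card_image inj_on_subset)
  show NM: "N \<le> M" using card_mono[OF _ sub] cN by simp
  have rest: "card ({..<M} - \<iota> ` {..<N}) \<le> D (N + n)"
  proof -
    have "card ({..<M} - \<iota> ` {..<N}) = M - N" using card_Diff_subset[OF _ sub] cN by simp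
    also have "\<dots> \<le> D N" using N(2) by simp
    also have "\<dots> \<le> D (N + n)" by (intro mono) simp
    finally show ?thesis .
  qed
  \<comment> \<open>The increments \<open>D (i + n) - D i\<close> telescope in steps of
    \<open>n\<close>, and each bad position contributes at least 1 to their sum.\<close>
  have shift: "(\<Sum>i<N. D (i + n)) + (\<Sum>i<n. D i) = (\<Sum>i<N. D i) + (\<Sum>i<n. D (N + i))"
  proof -
    have "(\<Sum>i<n + N. D i) = (\<Sum>i<n. D i) + (\<Sum>i<N. D (i + n))"
      by (induction N) (auto simp: add_ac)
    moreover have "(\<Sum>i<N + n. D i) = (\<Sum>i<N. D i) + (\<Sum>i<n. D (N + i))"
      by (induction n) (auto simp: add_ac)
    ultimately show ?thesis by (simp add: add_ac)
  qed
  have bad: "card Bad \<le> n * D (N + n)"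
  proof -
    have "card Bad = (\<Sum>i\<in>Bad. 1)" by simp
    also have "\<dots> \<le> (\<Sum>i\<in>Bad. D (i + n) - D i)"
    proof (rule sum_mono)
      fix i assume "i \<in> Bad"
      then show "1 \<le> D (i + n) - D i" using mono[of i "i + n"] by (auto simp: Bad_def)
    qed
    also have "\<dots> \<le> (\<Sum>i<N. D (i + n) - D i)" by (intro sum_mono2) (auto simp: Bad_def)
    also have "\<dots> = (\<Sum>i<N. D (i + n)) - (\<Sum>i<N. D i)"
      using mono by (intro sum_subtractf_nat) auto
    also have "\<dots> \<le> (\<Sum>i<n. D (N + i))" using shift by linarith
    also have "\<dots> \<le> (\<Sum>i<n. D (N + n))" by (intro sum_mono mono) auto
    finally show ?thesis by simp
  qed
  have fB: "finite Bad" by (simp add: Bad_def)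
  have same: "\<iota> i \<in> occurrences e b M \<longleftrightarrow> i \<in> occurrences a b N" if i: "i < N" "i \<notin> Bad" for i
  proof -
    have eq: "e (\<iota> i + k) = a (i + k)" if "k < n" for k
    proof -
      have "D (i + k) = D i"
        using mono[of i "i + k"] mono[of "i + k" "i + n"] that i by (auto simp: Bad_def)
      then show ?thesis using ea[of "i + k"] by (simp add: \<iota>_def add_ac)
    qed
    have "map (\<lambda>k. e (\<iota> i + k)) [0..<n] = map (\<lambda>k. a (i + k)) [0..<n]"
      using eq by auto
    moreover have "\<iota> i < M" using sub i by auto
    ultimately show ?thesis using i unfolding occurrences_def n_def by (simp only: mem_Collect_eq) simp
  qed
  have ltM: "occurrences e b M \<subseteq> {..<M}" and ltN: "occurrences a b N \<subseteq> {..<N}"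
    by (auto simp: occurrences_def)
  \<comment> \<open>An occurrence in \<open>e\<close> comes from one in \<open>a\<close>, starts at
    the image of a bad position, or starts at a letter outside the image of
    \<open>\<iota>\<close>.\<close>
  have "occurrences e b M \<subseteq> \<iota> ` occurrences a b N \<union> \<iota> ` Bad \<union> ({..<M} - \<iota> ` {..<N})"
    using same ltM by (auto simp: image_iff)
  then have "card (occurrences e b M) \<le> card (\<iota> ` occurrences a b N \<union> \<iota> ` Bad \<union> ({..<M} - \<iota> ` {..<N}))"
    using fB by (intro card_mono) auto
  also have "\<dots> \<le> card (\<iota> ` occurrences a b N) + card (\<iota> ` Bad) + card ({..<M} - \<iota> ` {..<N})"
    by (meson add_le_mono1 card_Un_le le_trans)
  also have "\<dots> \<le> card (occurrences a b N) + card Bad + D (N + n)"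
    using rest fB by (intro add_mono card_image_le) auto
  finally have 1: "card (occurrences e b M) \<le> card (occurrences a b N) + n * D (N + n) + D (N + n)"
    using bad by linarith
  have "\<iota> ` occurrences a b N \<subseteq> occurrences e b M \<union> \<iota> ` Bad"
    using same ltN by blast
  then have "card (\<iota> ` occurrences a b N) \<le> card (occurrences e b M \<union> \<iota> ` Bad)"
    using fB by (intro card_mono) auto
  also have "\<dots> \<le> card (occurrences e b M) + card (\<iota> ` Bad)" by (rule card_Un_le)
  also have "\<dots> \<le> card (occurrences e b M) + n * D (N + n)"
    using bad card_image_le[OF fB, of \<iota>] by linarith
  finally have 2: "card (occurrences a b N) \<le> card (occurrences e b M) + n * D (N + n)"
    using inj by (simp add: card_image inj_on_subset)
  have "real (card (occurrences e b M)) \<le> real (card (occurrences a b N) + n * D (N + n) + D (N + n))"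
    "real (card (occurrences a b N)) \<le> real (card (occurrences e b M) + n * D (N + n))"
    using 1 2 by (simp_all only: of_nat_le_iff)
  then show "\<bar>real (card (occurrences e b M)) - real (card (occurrences a b N))\<bar>
       \<le> (real (length b) + 1) * real (D (N + length b))"
    by (simp add: n_def abs_le_iff algebra_simps)
qed

text \<open>Each prefix of \<open>e\<close> is compared with the prefix of \<open>a\<close> of
  length \<open>\<nu> M\<close> that it contains; \<open>\<nu>\<close> is a generalized inverse of
  \<open>N + D N\<close>.\<close>

lemma frequency_insertion:
  fixes D :: "nat \<Rightarrow> nat"
  assumes "mono D" and ea: "\<And>i. e (i + D i) = a i"
    and sparse: "(\<lambda>i. real (D i) / real i) \<longlonglongrightarrow> 0"
    and freq: "(\<lambda>N. real (card (occurrences a b N)) / real N) \<longlonglongrightarrow> p"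
  shows "(\<lambda>N. real (card (occurrences e b N)) / real N) \<longlonglongrightarrow> p"
proof -
  define n where "n = length b"
  define \<nu> where "\<nu> M = (LEAST N. M \<le> N + D N)" for M
  have ex: "M \<le> \<nu> M + D (\<nu> M)" for M
    unfolding \<nu>_def by (rule LeastI[of _ M]) simp
  have least: "i + D i < M" if "i < \<nu> M" for i M
    using not_less_Least[of i "\<lambda>N. M \<le> N + D N"] that by (simp add: \<nu>_def)
  have \<nu>_le: "\<nu> M \<le> M" for M
    by (rule occurrences_insertion(1)[of D e a "\<nu> M" M]) (use assms(1) ea least ex in auto)
  have \<nu>_top: "filterlim \<nu> at_top sequentially"
  proof (rule filterlim_at_top[THEN iffD2], intro allI)
    fix Z
    have "Z \<le> \<nu> M" if "Z + D Z \<le> M" for M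
    proof (rule ccontr)
      assume "\<not> Z \<le> \<nu> M"
      then have "\<nu> M < Z" "D (\<nu> M) \<le> D Z" using assms(1) by (auto simp: mono_def)
      then show False using ex[of M] that by linarith
    qed
    then show "eventually (\<lambda>M. Z \<le> \<nu> M) sequentially"
      by (auto simp: eventually_sequentially)
  qed
  \<comment> \<open>The summands pay for displaced occurrences, for the error of the frequency in
    \<open>a\<close>, and for the difference between the lengths \<open>M\<close> and
    \<open>N\<close>.\<close>
  define h where "h N = (real n + 1) * (real (D (N + n)) / real N) +
    \<bar>real (card (occurrences a b N)) / real N - p\<bar> + \<bar>p\<bar> * (real (D N) / real N)" for N
  have "(\<lambda>N. real (D (N + n)) / real N) \<longlonglongrightarrow> 0"
  proof -
    have "(\<lambda>N. real (D (N + n)) / real (N + n)) \<longlonglongrightarrow> 0" by (rule LIMSEQ_ignore_initial_segment[OF sparse])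
    moreover have "(\<lambda>N. 1 + real n / real N) \<longlonglongrightarrow> 1 + 0"
      by (intro tendsto_intros lim_const_over_n)
    ultimately have "(\<lambda>N. real (D (N + n)) / real (N + n) * (1 + real n / real N)) \<longlonglongrightarrow> 0 * (1 + 0)"
      by (rule tendsto_mult)
    moreover have "eventually (\<lambda>N. real (D (N + n)) / real (N + n) * (1 + real n / real N) =
        real (D (N + n)) / real N) sequentially"
    proof (intro eventually_sequentiallyI[of 1])
      fix N :: nat assume "1 \<le> N"
      then have "1 + real n / real N = real (N + n) / real N" by (simp add: field_simps)
      then show "real (D (N + n)) / real (N + n) * (1 + real n / real N) = real (D (N + n)) / real N"
        using \<open>1 \<le> N\<close> by simp
    qed
    ultimately show ?thesis by (simp add: tendsto_cong)
  qed
  then have "h \<longlonglongrightarrow> (real n + 1) * 0 + \<bar>p - p\<bar> + \<bar>p\<bar> * 0"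
    unfolding h_def by (intro tendsto_intros freq sparse)
  then have "h \<longlonglongrightarrow> 0" by simp
  then have lim: "(\<lambda>M. h (\<nu> M)) \<longlonglongrightarrow> 0" by (rule filterlim_compose[OF _ \<nu>_top])
  have "eventually (\<lambda>M. \<nu> M \<ge> 1) sequentially"
    using \<nu>_top by (auto simp: filterlim_at_top)
  then have "eventually (\<lambda>M. norm (real (card (occurrences e b M)) / real M - p) \<le> h (\<nu> M)) sequentially"
  proof eventually_elim
    case (elim M)
    define N where "N = \<nu> M"
    have N: "real N > 0" "real N \<le> real M" "real M > 0" using elim \<nu>_le[of M] by (auto simp: N_def)
    let ?E = "real (card (occurrences e b M))" and ?A = "real (card (occurrences a b N))"
    have 1: "\<bar>?E - ?A\<bar> \<le> (real n + 1) * real (D (N + n))"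
      unfolding N_def n_def by (rule occurrences_insertion(2)[of D e a "\<nu> M" M]) (use assms(1) ea least ex in auto)
    have MN: "\<bar>real M - real N\<bar> \<le> real (D N)" using ex[of M] N(2) by (simp add: N_def)
    have "?E - p * M = (?E - ?A) + (?A - p * N) - p * (real M - real N)" by (simp add: algebra_simps)
    then have "\<bar>?E - p * M\<bar> \<le> \<bar>?E - ?A\<bar> + \<bar>?A - p * N\<bar> + \<bar>p * (real M - real N)\<bar>" by linarith
    also have "\<bar>p * (real M - real N)\<bar> \<le> \<bar>p\<bar> * real (D N)"
      using MN by (simp add: abs_mult mult_left_mono)
    finally have "\<bar>?E - p * M\<bar> \<le> (real n + 1) * real (D (N + n)) + \<bar>?A - p * N\<bar> + \<bar>p\<bar> * real (D N)"
      using 1 by linarith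
    also have "\<dots> = h N * N"
    proof -
      have "\<bar>?A - p * N\<bar> = \<bar>?A / N - p\<bar> * N" using N(1) by (simp add: abs_mult_pos field_simps)
      then show ?thesis using N(1) by (simp add: h_def field_simps)
    qed
    finally have *: "\<bar>?E - p * M\<bar> \<le> h N * N" .
    \<comment> \<open>The error was measured relative to \<open>N\<close>; replacing
      \<open>N\<close> by the larger \<open>M\<close> only weakens the bound.\<close>
    have "0 \<le> h N" by (simp add: h_def)
    then have "h N * N \<le> h N * M" using N(2) by (intro mult_left_mono)
    then have "\<bar>?E - p * M\<bar> / M \<le> h N" using * N(3) by (simp add: pos_divide_le_eq)
    moreover have "?E / M - p = (?E - p * M) / M" using N(3) by (simp add: field_simps)
    ultimately show ?case using N(3) by (simp add: N_def)
  qed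
  then have "(\<lambda>M. real (card (occurrences e b M)) / real M - p) \<longlonglongrightarrow> 0"
    using lim by (rule Lim_null_comparison)
  then show ?thesis by (simp add: LIM_zero_iff)
qed

lemma card_occurrences_singleton: "card (occurrences a [c] N) = count_list (map a [0..<N]) c"
proof (induction N)
  case (Suc N)
  have "occurrences a [c] (Suc N) = (if a N = c then insert N (occurrences a [c] N) else occurrences a [c] N)"
    by (auto simp: occurrences_def less_Suc_eq)
  moreover have "N \<notin> occurrences a [c] N" by (simp add: occurrences_def)
  ultimately show ?case using Suc by simp
qed (simp add: occurrences_def)

section \<open>The Borel hierarchy\<close>

lemma borel_Pi_1_iff: "borel_Pi 1 A \<longleftrightarrow> closed A"
proof
  assume "borel_Pi 1 A"
  then show "closed A"
  proof cases
    case (Pi_compl B)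
    have "open B" using Pi_compl(2) by (cases rule: borel_Sigma.cases) auto
    then show ?thesis using Pi_compl(1) by (simp add: closed_def)
  qed
next
  assume "closed A"
  then have "borel_Pi 1 (- (- A))" by (intro Pi_compl Sigma_open) (simp add: closed_def)
  then show "borel_Pi 1 A" by simp
qed

lemma borel_Pi_2_Inter:
  fixes U :: "nat \<Rightarrow> 'a::polish_space set"
  assumes "\<And>n. open (U n)"
  shows "borel_Pi 2 (\<Inter>n. U n)"
proof -
  have "borel_Pi 1 (- U n)" for n using assms by (intro borel_Pi_1_iff[THEN iffD2] closed_Compl)
  then have "borel_Sigma 2 (\<Union>n. - U n)" by (intro Sigma_Union[where \<eta> = "\<lambda>_. 1"]) auto
  then have "borel_Pi 2 (- (\<Union>n. - U n))" by (rule Pi_compl)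
  then show ?thesis by simp
qed

lemma closed_eq_Inter_open:
  fixes A :: "'a::metric_space set"
  assumes "closed A"
  obtains U :: "nat \<Rightarrow> 'a set" where "\<And>n. open (U n)" "A = (\<Inter>n. U n)"
proof
  let ?U = "\<lambda>n::nat. \<Union>x\<in>A. ball x (1 / (real n + 1))"
  show "open (?U n)" for n by auto
  have "y \<in> A" if y: "y \<in> (\<Inter>n. ?U n)" for y
  proof -
    have "y \<in> closure A"
      unfolding closure_approachable
    proof (intro allI impI)
      fix e :: real assume "0 < e"
      then obtain n where n: "1 / (real n + 1) < e"
        using reals_Archimedean by (auto simp: inverse_eq_divide add.commute)
      have "y \<in> ?U n" using y by blast
      then obtain x where "x \<in> A" "dist x y < 1 / (real n + 1)" by auto
      then show "\<exists>x\<in>A. dist x y < e" using n by (intro bexI[of _ x]) auto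
    qed
    then show ?thesis using assms by simp
  qed
  then show "A = (\<Inter>n. ?U n)" by auto
qed

text \<open>The sets united in a third-level union may have mixed levels 1 and 2; in a metrizable
  space both kinds are countable intersections of open sets.\<close>

lemma borel_Pi_le_2_D:
  fixes A :: "'a::polish_space set"
  assumes "borel_Pi \<xi> A" "1 \<le> \<xi>" "\<xi> < 3"
  obtains U :: "nat \<Rightarrow> 'a set" where "\<And>n. open (U n)" "A = (\<Inter>n. U n)"
proof -
  consider "\<xi> = 1" | "\<xi> = 2" using assms(2,3) by linarith
  then show thesis
  proof cases
    case 1
    then have "closed A" using assms(1) by (intro borel_Pi_1_iff[THEN iffD1]) simp
    then show thesis using closed_eq_Inter_open that by metis
  next
    case 2
    from assms(1) obtain B where B: "A = - B" "borel_Sigma \<xi> B" by (cases rule: borel_Pi.cases) auto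
    from B(2) 2 obtain \<eta> :: "nat \<Rightarrow> nat" and C where C: "\<And>n. 1 \<le> \<eta> n \<and> \<eta> n < \<xi>" "\<And>n. borel_Pi (\<eta> n) (C n)" "B = (\<Union>n. C n)"
      by (cases rule: borel_Sigma.cases) auto
    have "\<eta> n = 1" for n using C(1)[of n] 2 by linarith
    then have "closed (C n)" for n using C(2)[of n] borel_Pi_1_iff by metis
    then have "\<And>n. open (- C n)" "A = (\<Inter>n. - C n)" using B(1) C(3) by auto
    then show thesis using that by metis
  qed
qed

lemma borel_Pi_3_Inter:
  fixes A :: "'a::polish_space set" and B :: "'b \<Rightarrow> 'a set"
  assumes "countable I" "I \<noteq> {}" "\<And>i. i \<in> I \<Longrightarrow> borel_Pi 1 (B i) \<or> borel_Pi 2 (B i)"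
    and "A = - (\<Union>i\<in>I. B i)"
  shows "borel_Pi 3 A"
proof -
  let ?C = "\<lambda>n. B (from_nat_into I n)"
  have C: "borel_Pi (if borel_Pi 1 (?C n) then 1 else 2) (?C n)" for n
    using assms(3)[OF from_nat_into[OF assms(2), of n]] by auto
  have "borel_Sigma 3 (\<Union>n. ?C n)"
    by (rule Sigma_Union[OF _ _ C]) auto
  moreover have "(\<Union>n. ?C n) = (\<Union>i\<in>I. B i)"
    using range_from_nat_into[OF assms(2,1)] by (metis image_image)
  ultimately show ?thesis using assms(4) Pi_compl by metis
qed

text \<open>If every permitted prefix could be continued into the intersection, one could
  alternately append the value \<open>m\<close> and fix enough values to enter the next
  \<open>U n\<close>. The limit would lie in the intersection and yet take the value
  \<open>m\<close> infinitely often.\<close>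

lemma prefix_open_avoid:
  fixes f :: "(nat \<Rightarrow> nat) \<Rightarrow> 'a::polish_space"
  assumes cont: "\<And>y U. open U \<Longrightarrow> f y \<in> U \<Longrightarrow> \<exists>k. \<forall>y'. (\<forall>j<k. y' j = y j) \<longrightarrow> f y' \<in> U"
    and U: "\<And>n::nat. open (U n)"
    and top: "\<And>y. f y \<in> (\<Inter>n. U n) \<Longrightarrow> filterlim y at_top sequentially"
  obtains l \<tau> where "length \<sigma> \<le> l" "\<forall>j<length \<sigma>. \<tau> j = \<sigma> ! j" "\<forall>j\<ge>length \<sigma>. m \<le> \<tau> j"
    "\<forall>y. (\<forall>j<l. y j = \<tau> j) \<and> (\<forall>j\<ge>l. m \<le> y j) \<longrightarrow> f y \<notin> (\<Inter>n. U n)"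
proof -
  define P where "P l \<tau> \<longleftrightarrow> length \<sigma> \<le> l \<and> (\<forall>j<length \<sigma>. \<tau> j = \<sigma> ! j) \<and> (\<forall>j\<ge>length \<sigma>. m \<le> \<tau> j)"
    for l \<tau>
  define R where "R l \<tau> \<longleftrightarrow> (\<forall>y. (\<forall>j<l. y j = \<tau> j) \<and> (\<forall>j\<ge>l. m \<le> y j) \<longrightarrow> f y \<notin> (\<Inter>n. U n))" for l \<tau>
  have "\<exists>l \<tau>. P l \<tau> \<and> R l \<tau>"
  proof (rule ccontr)
    assume neg: "\<nexists>l \<tau>. P l \<tau> \<and> R l \<tau>"
    have dense: "\<exists>y. (\<forall>j<l. y j = \<tau> j) \<and> (\<forall>j\<ge>l. m \<le> y j) \<and> f y \<in> (\<Inter>n. U n)" if "P l \<tau>" for l \<tau>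
    proof -
      have "\<not> R l \<tau>" using neg that by blast
      then show ?thesis unfolding R_def by blast
    qed
    have step: "\<exists>l' \<tau>'. P l' \<tau>' \<and> l < l' \<and> (\<forall>j<l. \<tau>' j = \<tau> j) \<and> \<tau>' l = m \<and>
        (\<forall>y. (\<forall>j<l'. y j = \<tau>' j) \<longrightarrow> f y \<in> U n)" if Pl: "P l \<tau>" for l \<tau> n
    proof -
      have Q: "P (Suc l) (\<tau>(l := m))" using Pl by (auto simp: P_def)
      obtain y where y: "\<forall>j<Suc l. y j = (\<tau>(l := m)) j" "\<forall>j\<ge>Suc l. m \<le> y j" "f y \<in> (\<Inter>n. U n)"
        using dense[OF Q] by (elim exE conjE)
      then have fy: "f y \<in> U n" by blast
      obtain k where k: "\<forall>y'. (\<forall>j<k. y' j = y j) \<longrightarrow> f y' \<in> U n"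
        using cont[OF U[of n] fy] by (elim exE)
      have yl: "y j = \<tau> j" if "j < l" for j using y(1) that by auto
      have ym: "y l = m" using y(1) by auto
      have "m \<le> y j" if "length \<sigma> \<le> j" for j
      proof -
        consider "j < l" | "j = l" | "Suc l \<le> j" by linarith
        then show ?thesis
        proof cases
          case 1
          then show ?thesis using yl Pl that by (auto simp: P_def)
        qed (use ym y(2) in auto)
      qed
      \<comment> \<open>The new prefix covers both the appended \<open>m\<close> at position
        \<open>l\<close> and the \<open>k\<close> values that keep the image in
        \<open>U n\<close>.\<close>
      then have "P (max (Suc l) k) y" using Pl yl by (auto simp: P_def)
      then show ?thesis using k ym yl by (intro exI[of _ "max (Suc l) k"] exI[of _ y]) auto
    qed
    define \<tau>0 where "\<tau>0 = (\<lambda>j. if j < length \<sigma> then \<sigma> ! j else m)"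
    define Q where "Q = (\<lambda>n (s :: nat \<times> (nat \<Rightarrow> nat)) s'. fst s < fst s' \<and> (\<forall>j<fst s. snd s' j = snd s j) \<and>
        snd s' (fst s) = m \<and> (\<forall>y. (\<forall>j<fst s'. y j = snd s' j) \<longrightarrow> f y \<in> U n))"
    have "\<exists>s. \<forall>n. P (fst (s n)) (snd (s n)) \<and> Q n (s n) (s (Suc n))"
    proof (rule dependent_nat_choice)
      show "\<exists>x. P (fst x) (snd x)" by (intro exI[of _ "(length \<sigma>, \<tau>0)"]) (auto simp: \<tau>0_def P_def)
      show "\<exists>y. P (fst y) (snd y) \<and> Q n x y" if "P (fst x) (snd x)" for x n
        using step[OF that, of n] unfolding Q_def by (metis fst_conv snd_conv)
    qed
    then obtain s where sQ: "\<And>n. Q n (s n) (s (Suc n))" by blast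
    define L where "L n = fst (s n)" for n
    define t where "t n = snd (s n)" for n
    have L: "L n < L (Suc n)" and t: "j < L n \<Longrightarrow> t (Suc n) j = t n j" and tm: "t (Suc n) (L n) = m"
      and tU: "(\<And>j. j < L (Suc n) \<Longrightarrow> y j = t (Suc n) j) \<Longrightarrow> f y \<in> U n" for n j y
      using sQ[of n] by (auto simp: Q_def L_def t_def)
    have sm: "strict_mono L" using L by (simp add: strict_mono_Suc_iff)
    then have Lge: "n \<le> L n" for n by (rule strict_mono_imp_increasing)
    define y where "y j = t (Suc j) j" for j
    have stab: "t n' j = t n j" if "n \<le> n'" "j < L n" for n n' j
      using that
    proof (induction rule: dec_induct)
      case (step k)
      then have "j < L k" using strict_mono_less_eq[OF sm] by (meson less_le_trans)
      then show ?case using step t by simp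
    qed simp
    have yt: "y j = t n j" if "j < L n" for j n
    proof -
      have "j < L (Suc j)" using Lge[of "Suc j"] by linarith
      then show ?thesis using that stab[of n "Suc j" j] stab[of "Suc j" n j]
        unfolding y_def by (cases "n \<le> Suc j") auto
    qed
    have "f y \<in> (\<Inter>n. U n)" using tU yt by blast
    then have "eventually (\<lambda>j. Suc m \<le> y j) sequentially" using top by (auto simp: filterlim_at_top)
    then obtain K where K: "\<And>j. K \<le> j \<Longrightarrow> Suc m \<le> y j" by (auto simp: eventually_sequentially)
    \<comment> \<open>The value appended at stage \<open>K\<close> contradicts the bound
      \<open>Suc m\<close> there, because \<open>K \<le> L K\<close>.\<close>
    have "y (L K) = m" using yt[of "L K" "Suc K"] L[of K] tm by simp
    then show False using K[of "L K"] Lge[of K] by simp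
  qed
  then obtain l \<tau> where "P l \<tau>" "R l \<tau>" by blast
  then show thesis unfolding P_def R_def by (intro that[of l \<tau>]) auto
qed

text \<open>The sequences tending to infinity do not form a \<open>\<Sigma>\<^sup>0\<^sub>3\<close> set: given countably many
  \<open>G\<^sub>\<delta>\<close> sets of such sequences, each of them is nowhere dense among the sequences that extend a
  given finite word by values at least \<open>m\<close>, so one can escape the \<open>m\<close>-th set by fixing
  finitely many values, and then raise the bound to \<open>m + 1\<close>.\<close>

lemma not_borel_Sigma_3I:
  fixes f :: "(nat \<Rightarrow> nat) \<Rightarrow> 'a::polish_space"
  assumes cont: "\<And>y U. open U \<Longrightarrow> f y \<in> U \<Longrightarrow> \<exists>k. \<forall>y'. (\<forall>j<k. y' j = y j) \<longrightarrow> f y' \<in> U"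
    and red: "\<And>y. f y \<in> A \<longleftrightarrow> filterlim y at_top sequentially"
  shows "\<not> borel_Sigma 3 A"
proof
  assume "borel_Sigma 3 A"
  then obtain \<eta> :: "nat \<Rightarrow> nat" and C where C: "\<And>n. 1 \<le> \<eta> n \<and> \<eta> n < 3" "\<And>n. borel_Pi (\<eta> n) (C n)" "A = (\<Union>n. C n)"
    by (cases rule: borel_Sigma.cases) auto
  have avoid: "\<exists>s'. length s < length s' \<and> take (length s) s' = s \<and> (\<forall>j. length s \<le> j \<and> j < length s' \<longrightarrow> m \<le> s' ! j) \<and>
      (\<forall>y. (\<forall>j<length s'. y j = s' ! j) \<and> (\<forall>j\<ge>length s'. m \<le> y j) \<longrightarrow> f y \<notin> C m)" for m s
  proof -
    obtain U where U: "\<And>n::nat. open (U n)" "C m = (\<Inter>n. U n)"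
      using borel_Pi_le_2_D[OF C(2)[of m]] C(1)[of m] by metis
    have top: "filterlim y at_top sequentially" if "f y \<in> (\<Inter>n. U n)" for y
      using that red C(3) U(2) by blast
    obtain l \<tau> where "length s \<le> l" "\<forall>j<length s. \<tau> j = s ! j" "\<forall>j\<ge>length s. m \<le> \<tau> j"
      "\<forall>y. (\<forall>j<l. y j = \<tau> j) \<and> (\<forall>j\<ge>l. m \<le> y j) \<longrightarrow> f y \<notin> (\<Inter>n. U n)"
      by (rule prefix_open_avoid[of f U s m, OF cont U(1) top])
    note \<tau> = this(1) this(2,3,4)[rule_format]
    \<comment> \<open>One value beyond \<open>l\<close> is fixed, so that the word grows even if
      \<open>l\<close> equals the length of \<open>s\<close>.\<close>
    let ?s' = "map \<tau> [0..<Suc l]"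
    have "f y \<notin> C m" if "\<forall>j<length ?s'. y j = ?s' ! j" "\<forall>j\<ge>length ?s'. m \<le> y j" for y
      unfolding U(2)
    proof (rule \<tau>(4), intro conjI allI impI)
      fix j assume "j < l"
      then show "y j = \<tau> j" using that(1)[rule_format, of j] by (simp del: upt_Suc)
    next
      fix j assume "l \<le> j"
      then consider "j = l" | "Suc l \<le> j" by linarith
      then show "m \<le> y j"
      proof cases
        case 1
        then show ?thesis using that(1)[rule_format, of l] \<tau>(1,3) by (simp del: upt_Suc)
      qed (use that(2) in auto)
    qed
    moreover have "take (length s) ?s' = s"
      using \<tau>(1,2) by (intro nth_equalityI) (auto simp del: upt_Suc)
    ultimately show ?thesis using \<tau>(1,3)
      by (intro exI[of _ ?s']) (auto simp del: upt_Suc)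
  qed
  define Q where "Q = (\<lambda>m s s'. length s < length s' \<and> take (length s) s' = s \<and> (\<forall>j. length s \<le> j \<and> j < length s' \<longrightarrow> m \<le> s' ! j) \<and>
      (\<forall>y. (\<forall>j<length s'. y j = s' ! j) \<and> (\<forall>j\<ge>length s'. m \<le> y j) \<longrightarrow> f y \<notin> C m))"
  have "\<exists>S. \<forall>m. True \<and> Q m (S m) (S (Suc m))"
    by (rule dependent_nat_choice) (use avoid in \<open>auto simp: Q_def\<close>)
  then obtain S where S: "\<And>m. Q m (S m) (S (Suc m))" by blast
  define L where "L m = length (S m)" for m
  define y where "y j = S (Suc j) ! j" for j
  have L: "L m < L (Suc m)" and St: "j < L m \<Longrightarrow> S (Suc m) ! j = S m ! j"
    and Sm: "L m \<le> j \<Longrightarrow> j < L (Suc m) \<Longrightarrow> m \<le> S (Suc m) ! j"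
    and SC: "(\<And>j. j < L (Suc m) \<Longrightarrow> y j = S (Suc m) ! j) \<Longrightarrow> (\<And>j. j \<ge> L (Suc m) \<Longrightarrow> m \<le> y j) \<Longrightarrow> f y \<notin> C m" for m j
    using S[of m] unfolding Q_def L_def by (auto, metis nth_take)
  have sm: "strict_mono L" using L by (simp add: strict_mono_Suc_iff)
  then have Lge: "m \<le> L m" for m by (rule strict_mono_imp_increasing)
  have stab: "S n' ! j = S n ! j" if "n \<le> n'" "j < L n" for n n' j
    using that
  proof (induction rule: dec_induct)
    case (step k)
    then have "j < L k" using strict_mono_less_eq[OF sm] by (meson less_le_trans)
    then show ?case using step St by simp
  qed simp
  have yS: "y j = S n ! j" if "j < L n" for j n
  proof -
    have "j < L (Suc j)" using Lge[of "Suc j"] by linarith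
    then show ?thesis using that stab[of n "Suc j" j] stab[of "Suc j" n j]
      unfolding y_def by (cases "n \<le> Suc j") auto
  qed
  have ylow: "m \<le> y j" if "L m \<le> j" for m j
  proof -
    \<comment> \<open>The stage at which position \<open>j\<close> was filled, which forces
      \<open>y j\<close> to be at least \<open>k\<close>. As \<open>S 0\<close> is arbitrary, a
      position before \<open>L 0\<close> has no such bound; it is ruled out by
      \<open>L m \<le> j\<close>.\<close>
    define k where "k = (LEAST k. j < L (Suc k))"
    have k: "j < L (Suc k)" unfolding k_def
      by (rule LeastI[of _ j]) (use Lge[of "Suc j"] in linarith)
    have kj: "L k \<le> j"
    proof (cases k)
      case 0
      then have "m \<le> 0" using that k L strict_mono_less[OF sm, of m "Suc 0"] by auto
      then show ?thesis using 0 that by simp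
    next
      case (Suc i)
      then have "\<not> j < L (Suc i)" using not_less_Least[of i "\<lambda>k. j < L (Suc k)"] by (simp add: k_def)
      then show ?thesis using Suc by simp
    qed
    have "m < Suc k" using that k strict_mono_less[OF sm, of m "Suc k"] by linarith
    moreover have "k \<le> y j" using Sm[OF kj k] yS[OF k] by simp
    ultimately show ?thesis by linarith
  qed
  have "f y \<notin> C m" for m
  proof (rule SC)
    show "m \<le> y j" if "L (Suc m) \<le> j" for j using ylow[of m j] that L[of m] by linarith
  qed (use yS in blast)
  then have "f y \<notin> A" using C(3) by blast
  moreover have "filterlim y at_top sequentially"
    unfolding filterlim_at_top eventually_sequentially using ylow by blast
  ultimately show False using red by blast
qed

section \<open>The Hurwitz measure\<close>

abbreviation digit_seq :: "complex \<Rightarrow> nat \<Rightarrow> complex" where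
  "digit_seq z j \<equiv> hurwitz_digit (Suc j) z"

lemma hurwitz_normal_iff:
  "z \<in> hurwitz_normal M \<longleftrightarrow> z \<in> hurwitz_domain - gaussian_rationals \<and>
     (\<forall>b. b \<noteq> [] \<and> regular_word b \<longrightarrow>
       (\<lambda>N. real (card (occurrences (digit_seq z) b N)) / real N) \<longlonglongrightarrow> measure M (hurwitz_cylinder b))"
proof -
  have eq: "{j \<in> {0..<N}. map (\<lambda>k. hurwitz_digit (j + k) z) [1..<length b + 1] = b} = occurrences (digit_seq z) b N" for b N
  proof -
    have "map (\<lambda>k. hurwitz_digit (j + k) z) [1..<length b + 1] = map (\<lambda>k. digit_seq z (j + k)) [0..<length b]" for j
      by (intro nth_equalityI) (auto simp del: upt_Suc)
    then show ?thesis by (simp add: occurrences_def)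
  qed
  have gen: "(\<forall>n\<ge>1. \<forall>b. length b = n \<and> regular_word b \<longrightarrow> X n b) \<longleftrightarrow>
      (\<forall>b. b \<noteq> [] \<and> regular_word b \<longrightarrow> X (length b) b)" for X
    by (auto simp: Suc_le_eq)
  show ?thesis unfolding hurwitz_normal_def mem_Collect_eq gen eq ..
qed

text \<open>Translates visits of the orbit to cylinders, which the ergodic theorem counts, into
  occurrences of words.\<close>

lemma funpow_in_cylinder_iff:
  assumes "z \<in> hurwitz_domain" "\<And>j. (hurwitz_map ^^ j) z \<noteq> 0"
  shows "(hurwitz_map ^^ j) z \<in> hurwitz_cylinder b \<longleftrightarrow> map (\<lambda>k. digit_seq z (j + k)) [0..<length b] = b"
proof -
  have it: "(hurwitz_map ^^ i) ((hurwitz_map ^^ j) z) = (hurwitz_map ^^ (j + i)) z" for i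
    by (metis add.commute comp_apply funpow_add)
  have "(hurwitz_map ^^ j) z \<in> hurwitz_cylinder b \<longleftrightarrow>
      (\<forall>i\<in>{1..length b}. hurwitz_digit i ((hurwitz_map ^^ j) z) = b ! (i - 1))"
    using assms(2) hurwitz_map_funpow_domain[OF assms(1), of j] by (simp add: hurwitz_cylinder_def it)
  also have "\<dots> \<longleftrightarrow> (\<forall>k<length b. hurwitz_digit (Suc k) ((hurwitz_map ^^ j) z) = b ! k)"
  proof
    assume *: "\<forall>i\<in>{1..length b}. hurwitz_digit i ((hurwitz_map ^^ j) z) = b ! (i - 1)"
    show "\<forall>k<length b. hurwitz_digit (Suc k) ((hurwitz_map ^^ j) z) = b ! k"
      using *[rule_format, of "Suc k" for k] by auto
  next
    assume *: "\<forall>k<length b. hurwitz_digit (Suc k) ((hurwitz_map ^^ j) z) = b ! k"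
    show "\<forall>i\<in>{1..length b}. hurwitz_digit i ((hurwitz_map ^^ j) z) = b ! (i - 1)"
    proof
      fix i assume "i \<in> {1..length b}"
      then show "hurwitz_digit i ((hurwitz_map ^^ j) z) = b ! (i - 1)"
        using *[rule_format, of "i - 1"] by auto
    qed
  qed
  also have "\<dots> \<longleftrightarrow> (\<forall>k<length b. digit_seq z (j + k) = b ! k)"
    by (simp add: hurwitz_digit_def it)
  also have "\<dots> \<longleftrightarrow> map (\<lambda>k. digit_seq z (j + k)) [0..<length b] = b"
    by (subst list_eq_iff_nth_eq) simp
  finally show ?thesis .
qed

text \<open>At 0 the digit formula yields 0 by \<open>inverse 0 = 0\<close>, hence not the pivot.
  Positivity of the real part later shows that the pivot cylinder leaves out a set of positive
  measure.\<close>

lemma digit_pivot_not_arcs: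
  assumes "w \<in> hurwitz_domain" "hurwitz_digit 1 w = pivot"
  shows "w \<noteq> 0" "w \<notin> arcs" "Re w > 0"
proof -
  show nz: "w \<noteq> 0"
    using assms(2) by (auto simp: hurwitz_digit_def hurwitz_round_def pivot_def)
  have q: "hurwitz_map w \<in> closed_square" using hurwitz_map_domain domain_subset_closed_square by blast
  have "inverse w = pivot + hurwitz_map w" using inverse_eq_digit_plus_map[OF nz] assms(2) by simp
  then have w: "w = inverse (pivot + hurwitz_map w)" by (metis inverse_inverse_eq)
  then show "w \<notin> arcs" using pivot_branch(1)[OF q] by auto
  have "Re (pivot + hurwitz_map w) > 0" using q by (auto simp: pivot_def closed_square_def)
  then have "Re (inverse (pivot + hurwitz_map w)) > 0"
    by (simp add: zero_less_divide_iff add_pos_nonneg)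
  then show "Re w > 0" using w by simp
qed

section \<open>The pivot cylinder and countability of the words\<close>

lemma cylinder_pivot_eq: "hurwitz_cylinder [pivot] = {w \<in> hurwitz_domain. hurwitz_digit 1 w = pivot}"
  using digit_pivot_not_arcs(1) by (auto simp: hurwitz_cylinder_def)

lemma regular_pivot: "regular_word [pivot]"
proof -
  let ?U = "inverse -` ((+) pivot ` open_square) \<inter> (- {0})"
  have "open ((+) pivot ` open_square)" by (intro open_translation open_open_square)
  moreover have "continuous_on (- {0}) (inverse :: complex \<Rightarrow> complex)" by (intro continuous_intros) auto
  ultimately have U: "open ?U" by (subst Int_commute) (intro continuous_open_preimage, auto)
  have "?U \<subseteq> hurwitz_cylinder [pivot]"
  proof
    fix z assume "z \<in> ?U"
    then obtain q where q: "q \<in> open_square" "inverse z = pivot + q" by auto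
    then have "z = inverse (pivot + q)" by (metis inverse_inverse_eq)
    then have "z \<in> hurwitz_domain"
      using pivot_branch(1)[of q] q(1) open_square_subset_closed open_square_subset_domain by auto
    moreover have "hurwitz_digit 1 z = pivot"
      using q hurwitz_round_add[OF pivot_gauss, of q] open_square_subset_domain by (auto simp: hurwitz_digit_def)
    ultimately show "z \<in> hurwitz_cylinder [pivot]" by (simp add: cylinder_pivot_eq)
  qed
  then have "?U \<subseteq> interior (hurwitz_cylinder [pivot])" using U by (rule interior_maximal)
  moreover have "inverse pivot \<in> ?U"
  proof -
    have "pivot \<noteq> 0" by (simp add: pivot_def complex_eq_iff)
    moreover have "pivot = pivot + 0" "(0::complex) \<in> open_square" by (auto simp: open_square_def)
    ultimately show ?thesis by (auto simp: image_iff)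
  qed
  ultimately show ?thesis unfolding regular_word_def by blast
qed

lemma regular_word_gauss: "regular_word b \<Longrightarrow> b \<in> lists gauss_ints"
proof -
  assume "regular_word b"
  then obtain z where z: "z \<in> hurwitz_cylinder b" unfolding regular_word_def using interior_subset by blast
  have "b ! k \<in> gauss_ints" if "k < length b" for k
  proof -
    have "hurwitz_digit (Suc k) z = b ! (Suc k - 1)" using z that by (auto simp: hurwitz_cylinder_def)
    then show ?thesis by (metis diff_Suc_1 hurwitz_digit_def hurwitz_round_gauss)
  qed
  then show ?thesis by (auto simp: in_set_conv_nth)
qed

lemma countable_gauss_words: "countable (lists gauss_ints)"
proof -
  have "gauss_ints \<subseteq> (\<lambda>(m, n). Complex (of_int m) (of_int n)) ` UNIV"
  proof
    fix z assume "z \<in> gauss_ints"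
    then obtain m n where "z = Complex (of_int m) (of_int n)"
      by (auto simp: gauss_ints_def complex_eq_iff elim!: Ints_cases)
    then show "z \<in> (\<lambda>(m, n). Complex (of_int m) (of_int n)) ` UNIV" by force
  qed
  then have "countable gauss_ints" by (rule countable_subset) auto
  then show ?thesis by (rule countable_lists)
qed

lemma hurwitz_round_measurable [measurable]: "hurwitz_round \<in> borel_measurable borel"
proof -
  have "hurwitz_round = (\<lambda>z. complex_of_real (of_int \<lfloor>Re z + 1/2\<rfloor>) + \<i> * complex_of_real (of_int \<lfloor>Im z + 1/2\<rfloor>))"
    by (auto simp: hurwitz_round_def complex_eq_iff)
  moreover have "\<dots> \<in> borel_measurable borel" by measurable
  ultimately show ?thesis by simp
qed

context
  fixes M :: "complex measure"
  assumes M: "hurwitz_measure M"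
begin

lemma hurwitz_prob_space: "prob_space M" and hurwitz_ergodic: "ergodic_measure M hurwitz_map"
  and sets_hurwitz: "sets M = sets (restrict_space borel hurwitz_domain)"
  using M by (auto simp: hurwitz_measure_def)

lemma space_hurwitz: "space M = hurwitz_domain"
  using sets_eq_imp_space_eq[OF sets_hurwitz] by (simp add: space_restrict_space)

lemma domain_borel: "hurwitz_domain \<in> sets borel"
  unfolding hurwitz_domain_def by measurable

lemma cylinder_measurable: "hurwitz_cylinder b \<in> sets M"
proof -
  have T [measurable]: "hurwitz_map \<in> measurable M M"
    using hurwitz_ergodic by (simp add: ergodic_measure_def)
  have "(\<lambda>x. x) \<in> measurable (restrict_space borel hurwitz_domain) borel"
    by (rule measurable_restrict_space1) simp
  then have id: "(\<lambda>x. x) \<in> borel_measurable M"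
    by (simp only: measurable_cong_sets[OF sets_hurwitz refl])
  have [measurable]: "(hurwitz_map ^^ j) \<in> borel_measurable M" for j
  proof -
    have "(hurwitz_map ^^ j) \<in> measurable M M" by (induction j) auto
    then show ?thesis using measurable_compose[OF _ id] by blast
  qed
  have "hurwitz_cylinder b = {z \<in> space M. \<forall>j\<in>{1..length b}. (hurwitz_map ^^ (j - 1)) z \<noteq> 0 \<and>
      hurwitz_round (inverse ((hurwitz_map ^^ (j - 1)) z)) = b ! (j - 1)}"
    by (simp add: hurwitz_cylinder_def space_hurwitz hurwitz_digit_def)
  also have "\<dots> \<in> sets M" by measurable
  finally show ?thesis .
qed

text \<open>An \<open>M\<close>-null set is Lebesgue null by equivalence, and such a set contains no
  nonempty open set.\<close>

lemma hurwitz_measure_pos: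
  assumes "A \<in> sets M" "open U" "U \<noteq> {}" "U \<subseteq> A"
  shows "measure M A > 0"
proof (rule ccontr)
  interpret prob_space M by (rule hurwitz_prob_space)
  assume "\<not> measure M A > 0"
  then have "measure M A = 0" using measure_nonneg[of M A] by linarith
  then have "A \<in> null_sets M" using assms(1) by (simp add: null_sets_def emeasure_eq_measure)
  then have "A \<in> null_sets (restrict_space lborel hurwitz_domain)"
    using M by (auto simp: hurwitz_measure_def absolutely_continuous_def)
  then have "A \<in> null_sets lborel" using domain_borel by (subst (asm) null_sets_restrict_space) auto
  then have "A \<in> null_sets lebesgue" by (rule null_sets_completionI)
  then have "negligible U" using assms(4) negligible_iff_null_sets negligible_subset by blast
  then show False using assms(2,3) open_not_negligible by blast
qed

text \<open>The lower bound makes the pivot recur in every normal orbit; the upper bound makes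
  surplus pivots detectable.\<close>

lemma cylinder_pivot_measure:
  "0 < measure M (hurwitz_cylinder [pivot])" "measure M (hurwitz_cylinder [pivot]) < 1"
proof -
  interpret prob_space M by (rule hurwitz_prob_space)
  show "0 < measure M (hurwitz_cylinder [pivot])"
    using regular_pivot interior_subset unfolding regular_word_def
    by (intro hurwitz_measure_pos[OF cylinder_measurable open_interior]) auto
  let ?U = "open_square \<inter> {z. Re z < 0}"
  have "measure M (space M - hurwitz_cylinder [pivot]) > 0"
  proof (rule hurwitz_measure_pos)
    show "open ?U" by (intro open_Int open_open_square open_Collect_less continuous_intros)
    have "Complex (-1/4) 0 \<in> ?U" by (simp add: open_square_def)
    then show "?U \<noteq> {}" by blast
    show "?U \<subseteq> space M - hurwitz_cylinder [pivot]"
      using digit_pivot_not_arcs(3) open_square_subset_domain by (force simp: space_hurwitz cylinder_pivot_eq)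
  qed (use cylinder_measurable in auto)
  then show "measure M (hurwitz_cylinder [pivot]) < 1" using prob_compl[OF cylinder_measurable] by simp
qed

text \<open>Otherwise the number of occurrences would be bounded and the frequency 0.\<close>

lemma frequency_pivot_imp:
  assumes "(\<lambda>N. real (card (occurrences (digit_seq z) [pivot] N)) / real N) \<longlonglongrightarrow>
      measure M (hurwitz_cylinder [pivot])"
  shows "\<exists>j\<ge>i. digit_seq z j = pivot"
proof (rule ccontr)
  assume "\<not> ?thesis"
  then have "occurrences (digit_seq z) [pivot] N \<subseteq> {..<i}" for N
    by (auto simp: occurrences_def) (meson linorder_not_le)
  then have "card (occurrences (digit_seq z) [pivot] N) \<le> i" for N
    using card_mono[of "{..<i}"] by fastforce
  then have "norm (real (card (occurrences (digit_seq z) [pivot] N)) / real N) \<le> real i / real N" for N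
    by (simp add: divide_right_mono)
  then have "(\<lambda>N. real (card (occurrences (digit_seq z) [pivot] N)) / real N) \<longlonglongrightarrow> 0"
    by (intro Lim_null_comparison[OF _ lim_const_over_n[of "real i"]]) auto
  then show False using LIMSEQ_unique[OF assms] cylinder_pivot_measure(1) by auto
qed

lemma generic_point:
  obtains z where "z \<in> hurwitz_domain" "\<And>j. (hurwitz_map ^^ j) z \<noteq> 0"
    "\<And>b. b \<in> lists gauss_ints \<Longrightarrow>
      (\<lambda>N. real (card (occurrences (digit_seq z) b N)) / real N) \<longlonglongrightarrow> measure M (hurwitz_cylinder b)"
proof -
  interpret prob_space M by (rule hurwitz_prob_space)
  \<comment> \<open>Visits to cylinders are counted instead of digits, since the two agree only once
    the orbit is known to avoid 0.\<close>
  let ?V = "\<lambda>z b N. {j \<in> {0..<N}. (hurwitz_map ^^ j) z \<in> hurwitz_cylinder b}"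
  let ?P = "\<lambda>z. \<forall>b\<in>lists gauss_ints. (\<lambda>N. real (card (?V z b N)) / real N) \<longlonglongrightarrow> measure M (hurwitz_cylinder b)"
  have AE: "AE z in M. ?P z"
    by (subst AE_ball_countable[OF countable_gauss_words])
      (intro ballI birkhoff_indicator hurwitz_prob_space hurwitz_ergodic cylinder_measurable)
  have "\<exists>z\<in>space M. ?P z"
  proof (rule ccontr)
    assume *: "\<not> ?thesis"
    have "AE z in M. False" using AE AE_space by eventually_elim (use * in blast)
    then show False by simp
  qed
  then obtain z where z: "z \<in> hurwitz_domain" "?P z" using space_hurwitz by auto
  \<comment> \<open>An orbit that reaches 0 stays there, outside the pivot cylinder, against the
    positive frequency of visits.\<close>
  have nz: "(hurwitz_map ^^ j) z \<noteq> 0" for j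
  proof
    assume j: "(hurwitz_map ^^ j) z = 0"
    have "(hurwitz_map ^^ i) z = 0" if "j \<le> i" for i
    proof -
      have "(hurwitz_map ^^ i) z = (hurwitz_map ^^ (i - j)) ((hurwitz_map ^^ j) z)"
        using that by (metis comp_apply funpow_add le_add_diff_inverse2)
      then show ?thesis using j by (simp add: hurwitz_map_zero_funpow)
    qed
    moreover have "0 \<notin> hurwitz_cylinder [pivot]" using digit_pivot_not_arcs(1) by (auto simp: cylinder_pivot_eq)
    ultimately have "?V z [pivot] N \<subseteq> {..<j}" for N
      by (metis (mono_tags, lifting) lessThan_iff linorder_not_le mem_Collect_eq subsetI)
    then have "card (?V z [pivot] N) \<le> j" for N
      using card_mono[of "{..<j}"] by fastforce
    then have "norm (real (card (?V z [pivot] N)) / real N) \<le> real j / real N" for N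
      by (simp add: divide_right_mono)
    then have "(\<lambda>N. real (card (?V z [pivot] N)) / real N) \<longlonglongrightarrow> 0"
      by (intro Lim_null_comparison[OF _ lim_const_over_n[of "real j"]]) auto
    moreover have "[pivot] \<in> lists gauss_ints" using pivot_gauss by simp
    ultimately show False using LIMSEQ_unique z(2) cylinder_pivot_measure(1) by fastforce
  qed
  have "?V z b N = occurrences (digit_seq z) b N" for b N
    using funpow_in_cylinder_iff[OF z(1) nz] by (simp add: occurrences_def)
  then show thesis using that[OF z(1) nz] z(2) by simp
qed

end

section \<open>Normality is a third-level condition\<close>

definition regular_pts :: "nat \<Rightarrow> complex set" where
  "regular_pts n = {z. \<forall>j\<le>n. (hurwitz_map ^^ j) z \<in> open_square - arcs}"

text \<open>The half-integer lines, where rounding jumps, belong to \<open>arcs\<close>, so only the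
  open translate of the square remains.\<close>

lemma open_round_eq: "open {v. v \<notin> arcs \<and> hurwitz_round v = d}"
proof (cases "d \<in> gauss_ints")
  case True
  have "{v. v \<notin> arcs \<and> hurwitz_round v = d} = - arcs \<inter> (+) d ` open_square"
  proof (intro set_eqI iffI)
    fix v assume v: "v \<in> {v. v \<notin> arcs \<and> hurwitz_round v = d}"
    have "- d + v \<notin> arcs" using v arcs_translate[OF gauss_ints_minus[OF True]] by simp
    moreover have "- d + v \<in> closed_square"
      using v hurwitz_round_diff_domain[of v] domain_subset_closed_square by auto
    ultimately have "- d + v \<in> open_square" by (rule square_boundary_arcs[rotated])
    then have "d + (- d + v) \<in> (+) d ` open_square" by (rule imageI)
    then show "v \<in> - arcs \<inter> (+) d ` open_square" using v by simp
  next
    fix v assume "v \<in> - arcs \<inter> (+) d ` open_square"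
    then show "v \<in> {v. v \<notin> arcs \<and> hurwitz_round v = d}"
      using hurwitz_round_add[OF True] open_square_subset_domain by auto
  qed
  then show ?thesis using closed_arcs open_translation[OF open_open_square] by auto
next
  case False
  then have "{v. v \<notin> arcs \<and> hurwitz_round v = d} = {}" using hurwitz_round_gauss by auto
  then show ?thesis by (simp only: open_empty)
qed

lemma continuous_on_round: "continuous_on (- arcs) hurwitz_round"
proof -
  have "open (hurwitz_round -` B \<inter> - arcs)" for B
  proof -
    have "hurwitz_round -` B \<inter> - arcs = (\<Union>d\<in>B. {v. v \<notin> arcs \<and> hurwitz_round v = d})" by auto
    then show ?thesis using open_round_eq by auto
  qed
  then show ?thesis using continuous_on_open_vimage closed_arcs by (metis open_Compl)
qed

definition map_pts :: "complex set" where
  "map_pts = {w \<in> open_square - arcs. inverse w \<notin> arcs}"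

lemma open_vimage_inverse: "open B \<Longrightarrow> open {w \<in> open_square - arcs. inverse w \<in> B}"
proof -
  assume B: "open B"
  have "continuous_on (open_square - arcs) (inverse :: complex \<Rightarrow> complex)"
    using zero_in_arcs by (intro continuous_intros) auto
  then have "open (inverse -` B \<inter> (open_square - arcs))"
    using continuous_on_open_vimage[of "open_square - arcs"] open_open_square closed_arcs B
    by (metis open_Diff)
  moreover have "inverse -` B \<inter> (open_square - arcs) = {w \<in> open_square - arcs. inverse w \<in> B}" by auto
  ultimately show ?thesis by simp
qed

lemma open_map_pts: "open map_pts"
  using open_vimage_inverse[OF open_Compl[OF closed_arcs]] by (simp add: map_pts_def)

lemma continuous_on_hurwitz_map: "continuous_on map_pts hurwitz_map"
proof -
  have nz: "w \<noteq> 0" if "w \<in> map_pts" for w using that zero_in_arcs by (auto simp: map_pts_def)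
  have inv: "continuous_on map_pts (inverse :: complex \<Rightarrow> complex)" using nz by (intro continuous_intros) auto
  have "continuous_on map_pts (\<lambda>w. hurwitz_round (inverse w))"
    by (rule continuous_on_compose2[OF continuous_on_round inv]) (auto simp: map_pts_def)
  then have "continuous_on map_pts (\<lambda>w. inverse w - hurwitz_round (inverse w))"
    by (intro continuous_intros inv)
  then show ?thesis by (rule continuous_on_eq) (use nz in \<open>simp add: hurwitz_map_def\<close>)
qed

lemma hurwitz_map_regular_iff:
  assumes "w \<in> open_square - arcs"
  shows "hurwitz_map w \<in> open_square - arcs \<longleftrightarrow> w \<in> map_pts"
proof -
  have "w \<noteq> 0" using assms zero_in_arcs by auto
  then have "hurwitz_map w = - hurwitz_round (inverse w) + inverse w" by (simp add: hurwitz_map_def)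
  then have "hurwitz_map w \<in> arcs \<longleftrightarrow> inverse w \<in> arcs"
    using arcs_translate[OF gauss_ints_minus[OF hurwitz_round_gauss]] by simp
  moreover have "hurwitz_map w \<in> closed_square" using hurwitz_map_domain domain_subset_closed_square by blast
  ultimately show ?thesis using assms square_boundary_arcs by (auto simp: map_pts_def)
qed

lemma regular_pts_Suc: "regular_pts (Suc n) = regular_pts n \<inter> (hurwitz_map ^^ n) -` map_pts"
proof -
  have "(hurwitz_map ^^ Suc n) z \<in> open_square - arcs \<longleftrightarrow> (hurwitz_map ^^ n) z \<in> map_pts"
    if "z \<in> regular_pts n" for z
    using hurwitz_map_regular_iff[of "(hurwitz_map ^^ n) z"] that by (simp add: regular_pts_def)
  then show ?thesis by (auto simp: regular_pts_def le_Suc_eq)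
qed

text \<open>Both claims are proved together: the next set is a preimage of \<open>map_pts\<close>
  under the continuous iterate on the present open set.\<close>

lemma regular_pts_open_continuous:
  "open (regular_pts n) \<and> continuous_on (regular_pts n) (hurwitz_map ^^ n)"
proof (induction n)
  case 0
  have "regular_pts 0 = open_square - arcs" by (auto simp: regular_pts_def)
  then show ?case using open_open_square closed_arcs by (auto simp: id_def)
next
  case (Suc n)
  then have "open (regular_pts n \<inter> (hurwitz_map ^^ n) -` map_pts)"
    using open_map_pts by (intro continuous_open_preimage) auto
  moreover have "continuous_on (regular_pts (Suc n)) (hurwitz_map \<circ> (hurwitz_map ^^ n))"
  proof (rule continuous_on_compose)
    show "continuous_on (regular_pts (Suc n)) (hurwitz_map ^^ n)"
      using Suc by (auto simp: regular_pts_Suc intro: continuous_on_subset)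
    show "continuous_on ((hurwitz_map ^^ n) ` regular_pts (Suc n)) hurwitz_map"
      by (rule continuous_on_subset[OF continuous_on_hurwitz_map]) (auto simp: regular_pts_Suc)
  qed
  ultimately show ?case by (simp add: regular_pts_Suc)
qed

lemma regular_pts_antimono: "m \<le> n \<Longrightarrow> regular_pts n \<subseteq> regular_pts m"
  by (auto simp: regular_pts_def)

text \<open>The digit rounds the inverse of the iterate of index \<open>n\<close>. That this inverse
  is off \<open>arcs\<close> amounts to regularity of the next iterate, hence
  \<open>Suc n\<close>.\<close>

lemma open_digit_eq: "open {z \<in> regular_pts (Suc n). digit_seq z n = d}"
proof -
  let ?B = "{w \<in> open_square - arcs. inverse w \<in> {v. v \<notin> arcs \<and> hurwitz_round v = d}}"
  have "open (regular_pts n \<inter> (hurwitz_map ^^ n) -` ?B)"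
    using regular_pts_open_continuous[of n] open_vimage_inverse[OF open_round_eq[of d]]
    by (intro continuous_open_preimage) auto
  moreover have "regular_pts n \<inter> (hurwitz_map ^^ n) -` ?B = {z \<in> regular_pts (Suc n). digit_seq z n = d}"
    by (auto simp: regular_pts_Suc map_pts_def hurwitz_digit_def)
  ultimately show ?thesis by simp
qed

lemma open_occurrences:
  assumes "N + length b \<le> K"
  shows "open {z \<in> regular_pts K. Q (occurrences (digit_seq z) b N)}"
proof (subst open_subopen, intro ballI)
  fix z assume z: "z \<in> {z \<in> regular_pts K. Q (occurrences (digit_seq z) b N)}"
  let ?V = "regular_pts K \<inter> (\<Inter>j\<in>{..<K}. {z' \<in> regular_pts (Suc j). digit_seq z' j = digit_seq z j})"
  have V: "open ?V" using regular_pts_open_continuous open_digit_eq by (intro open_Int open_INT) auto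
  have "z \<in> regular_pts (Suc j)" if "j < K" for j
    using z regular_pts_antimono[of "Suc j" K] that by auto
  then have zV: "z \<in> ?V" using z by auto
  have occ: "occurrences (digit_seq z') b N = occurrences (digit_seq z) b N" if "z' \<in> ?V" for z'
  proof -
    have eq: "map (\<lambda>k. digit_seq z' (j + k)) [0..<length b] = map (\<lambda>k. digit_seq z (j + k)) [0..<length b]"
      if "j < N" for j
      using \<open>z' \<in> ?V\<close> that assms by (intro map_cong) auto
    show ?thesis unfolding occurrences_def by (intro Collect_cong conj_cong refl) (simp only: eq atLeastLessThan_iff)
  qed
  show "\<exists>T. open T \<and> z \<in> T \<and> T \<subseteq> {z \<in> regular_pts K. Q (occurrences (digit_seq z) b N)}"
  proof (intro exI[of _ ?V] conjI subsetI)
    show "open ?V" by (rule V)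
    show "z \<in> ?V" by (rule zV)
  next
    fix z' assume z': "z' \<in> ?V"
    then have "z' \<in> regular_pts K" by blast
    then show "z' \<in> {z \<in> regular_pts K. Q (occurrences (digit_seq z) b N)}"
      using z occ[OF z'] by (simp only: mem_Collect_eq)
  qed
qed

text \<open>An orbit that meets \<open>arcs\<close> stays there and omits the pivot digit from then on.\<close>

lemma hurwitz_normal_subset_regular_pts:
  assumes "hurwitz_measure M" "z \<in> hurwitz_normal M"
  shows "z \<in> regular_pts K"
proof -
  have z: "z \<in> hurwitz_domain"
    and freq: "(\<lambda>N. real (card (occurrences (digit_seq z) [pivot] N)) / real N) \<longlonglongrightarrow> measure M (hurwitz_cylinder [pivot])"
    using assms(2) regular_pivot by (auto simp: hurwitz_normal_iff)
  have "(hurwitz_map ^^ j) z \<in> open_square - arcs" for j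
  proof -
    have dom: "(hurwitz_map ^^ i) z \<in> hurwitz_domain" for i by (rule hurwitz_map_funpow_domain[OF z])
    have "(hurwitz_map ^^ j) z \<notin> arcs"
    proof
      assume j: "(hurwitz_map ^^ j) z \<in> arcs"
      have arcs: "(hurwitz_map ^^ i) z \<in> arcs" if "j \<le> i" for i
        using that
      proof (induction rule: dec_induct)
        case (step k)
        then show ?case using hurwitz_map_arcs[OF dom[of k]] by simp
      qed (rule j)
      obtain i where "j \<le> i" "digit_seq z i = pivot" using frequency_pivot_imp[OF assms(1) freq] by blast
      moreover have "hurwitz_digit 1 ((hurwitz_map ^^ i) z) = digit_seq z i" by (simp add: hurwitz_digit_def)
      ultimately show False using digit_pivot_not_arcs(2)[OF dom[of i]] arcs by simp
    qed
    then show ?thesis using dom[of j] domain_subset_closed_square square_boundary_arcs by blast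
  qed
  then show ?thesis by (simp add: regular_pts_def)
qed

text \<open>The complement is the countable union of the closed sets on which regularity fails by
  time \<open>K\<close> and the sets on which, for some word, the frequency deviates by more than
  \<open>1 / (k + 1)\<close> for infinitely many \<open>N\<close>.\<close>

lemma hurwitz_normal_Pi_3:
  assumes M: "hurwitz_measure M"
  shows "borel_Pi 3 (hurwitz_normal M)"
proof -
  \<comment> \<open>The strict inequality only concerns finitely many digits; within
    \<open>regular_pts\<close> these are locally constant, so the set is open.\<close>
  define O' where "O' b k N = {z \<in> regular_pts (N + length b).
      \<bar>real (card (occurrences (digit_seq z) b N)) / real N - measure M (hurwitz_cylinder b)\<bar> > 1 / (real k + 1)}"
    for b k N
  define W where "W = {b. b \<noteq> [] \<and> regular_word b}"
  define B where "B = case_sum (\<lambda>K. - regular_pts K) (\<lambda>(b, k). \<Inter>n. \<Union>N\<in>{n..}. O' b k N)"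
  let ?I = "(UNIV :: nat set) <+> (W \<times> (UNIV :: nat set))"
  have O': "open (O' b k N)" for b k N
    unfolding O'_def by (rule open_occurrences) simp
  have cW: "countable W" using regular_word_gauss countable_gauss_words
    by (auto simp: W_def intro: countable_subset)
  have normal: "z \<in> hurwitz_normal M \<longleftrightarrow> (\<forall>K. z \<in> regular_pts K) \<and>
      (\<forall>b\<in>W. \<forall>k. \<exists>n. \<forall>N\<ge>n. z \<notin> O' b k N)" for z
  proof (cases "\<forall>K. z \<in> regular_pts K")
    case True
    have z: "z \<in> hurwitz_domain" using True[rule_format, of 0] open_square_subset_domain by (auto simp: regular_pts_def)
    have "(hurwitz_map ^^ j) z \<noteq> 0" for j using True[rule_format, of j] zero_in_arcs by (auto simp: regular_pts_def)
    \<comment> \<open>Gaussian rationals drop out by themselves, because their orbits reach 0, a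
      point of \<open>arcs\<close>.\<close>
    then have irr: "z \<notin> gaussian_rationals" using gaussian_rational_orbit_zero[OF z] by blast
    have lim: "X \<longlonglongrightarrow> p \<longleftrightarrow> (\<forall>k::nat. \<exists>n. \<forall>N\<ge>n. \<not> \<bar>X N - p\<bar> > 1 / (real k + 1))" for X :: "nat \<Rightarrow> real" and p
    proof
      assume X: "X \<longlonglongrightarrow> p"
      have ex: "\<exists>n. \<forall>N\<ge>n. \<bar>X N - p\<bar> < r" if "r > 0" for r using LIMSEQ_D[OF X that] by simp
      show "\<forall>k::nat. \<exists>n. \<forall>N\<ge>n. \<not> \<bar>X N - p\<bar> > 1 / (real k + 1)"
      proof
        fix k :: nat
        have "0 < 1 / (real k + 1)" by simp
        from ex[OF this] show "\<exists>n. \<forall>N\<ge>n. \<not> \<bar>X N - p\<bar> > 1 / (real k + 1)" by (meson order_less_asym)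
      qed
    next
      assume *: "\<forall>k::nat. \<exists>n. \<forall>N\<ge>n. \<not> \<bar>X N - p\<bar> > 1 / (real k + 1)"
      show "X \<longlonglongrightarrow> p"
      proof (rule LIMSEQ_I)
        fix r :: real assume "0 < r"
        then obtain k where k: "1 / (real k + 1) < r"
          using reals_Archimedean by (auto simp: inverse_eq_divide add.commute)
        obtain n where "\<forall>N\<ge>n. \<not> \<bar>X N - p\<bar> > 1 / (real k + 1)" using * by blast
        then show "\<exists>no. \<forall>n\<ge>no. norm (X n - p) < r" using k by (intro exI[of _ n]) force
      qed
    qed
    have "z \<in> O' b k N \<longleftrightarrow>
        \<bar>real (card (occurrences (digit_seq z) b N)) / real N - measure M (hurwitz_cylinder b)\<bar> > 1 / (real k + 1)" for b k N
      using True by (simp add: O'_def)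
    then show ?thesis using True z irr by (simp add: hurwitz_normal_iff lim W_def)
  next
    case False
    then show ?thesis using hurwitz_normal_subset_regular_pts[OF M] by blast
  qed
  show ?thesis
  proof (rule borel_Pi_3_Inter[where I = ?I and B = B])
    show "countable ?I" using cW by (intro countable_Plus countable_SIGMA) auto
    show "?I \<noteq> {}" by auto
    show "borel_Pi 1 (B i) \<or> borel_Pi 2 (B i)" if "i \<in> ?I" for i
    proof (cases i)
      case (Inl K)
      have "closed (- regular_pts K)" using regular_pts_open_continuous by (simp add: closed_Compl)
      then have "borel_Pi 1 (- regular_pts K)" by (rule borel_Pi_1_iff[THEN iffD2])
      then show ?thesis unfolding Inl B_def by simp
    next
      case (Inr x)
      obtain b k where "x = (b, k)" by fastforce
      moreover have "borel_Pi 2 (\<Inter>n. \<Union>N\<in>{n..}. O' b k N)" using O' by (intro borel_Pi_2_Inter) auto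
      ultimately show ?thesis unfolding Inr B_def by simp
    qed
    have mem: "z \<in> (\<Union>i\<in>?I. B i) \<longleftrightarrow> (\<exists>K. z \<notin> regular_pts K) \<or> (\<exists>b\<in>W. \<exists>k. \<forall>n. \<exists>N\<ge>n. z \<in> O' b k N)" for z
      by (fastforce simp: B_def Plus_def)
    show "hurwitz_normal M = - (\<Union>i\<in>?I. B i)"
    proof (rule set_eqI)
      show "z \<in> hurwitz_normal M \<longleftrightarrow> z \<in> - (\<Union>i\<in>?I. B i)" for z
        unfolding normal Compl_iff mem by simp
    qed
  qed
qed

section \<open>Inserting pivots into a generic expansion\<close>

lemma count_list_replicate_self: "count_list (replicate n c) c = n"
  by (induction n) auto

text \<open>The digit before position \<open>s k\<close> is a pivot, so every block between
  consecutive positions is full. Of the two factors \<open>Suc k\<close> in the growth condition,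
  one pays for the number of earlier insertions and the other makes their sum negligible.\<close>

locale pivot_insertion =
  fixes M :: "complex measure" and x :: complex and s :: "nat \<Rightarrow> nat"
  assumes M: "hurwitz_measure M"
    and x: "x \<in> hurwitz_domain" "\<And>j. (hurwitz_map ^^ j) x \<noteq> 0"
    and freq: "\<And>b. b \<in> lists gauss_ints \<Longrightarrow>
      (\<lambda>N. real (card (occurrences (digit_seq x) b N)) / real N) \<longlonglongrightarrow> measure M (hurwitz_cylinder b)"
    and s_pos: "\<And>k. 0 < s k" and s_pivot: "\<And>k. digit_seq x (s k - 1) = pivot"
    and s_less: "\<And>k. s k < s (Suc k)" and s_sparse: "\<And>k. Suc k * Suc k * s k \<le> s (Suc k)"
begin

definition ins :: "(nat \<Rightarrow> nat) \<Rightarrow> nat \<Rightarrow> nat" where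
  "ins y k = s k div Suc (y k)"

primrec block_word :: "(nat \<Rightarrow> nat) \<Rightarrow> nat \<Rightarrow> complex list" where
  "block_word y 0 = map (digit_seq x) [0..<s 0] @ replicate (ins y 0) pivot"
| "block_word y (Suc k) =
     block_word y k @ map (digit_seq x) [s k..<s (Suc k)] @ replicate (ins y (Suc k)) pivot"

text \<open>This is the function \<open>D\<close> of the insertion lemmas; the insertion at
  \<open>s j\<close> stands in front of the letter with index \<open>s j\<close>, hence
  \<open>s j \<le> i\<close>.\<close>

definition inserted :: "(nat \<Rightarrow> nat) \<Rightarrow> nat \<Rightarrow> nat" where
  "inserted y i = sum (ins y) {j. s j \<le> i}"

lemma strict_mono_s: "strict_mono s"
  using s_less by (simp add: strict_mono_Suc_iff)

lemma s_ge: "k \<le> s k"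
  by (rule strict_mono_imp_increasing[OF strict_mono_s])

lemma s_index:
  assumes "s 0 \<le> i"
  obtains k where "s k \<le> i" "i < s (Suc k)"
proof -
  define k where "k = (LEAST k. i < s k)"
  have "i < s (Suc i)" using s_ge[of "Suc i"] by linarith
  then have k: "i < s k" unfolding k_def by (rule LeastI)
  obtain k' where k': "k = Suc k'" using assms k by (cases k) auto
  then have "\<not> i < s k'" using not_less_Least[of k' "\<lambda>k. i < s k"] by (simp add: k_def)
  then show thesis using that[of k'] k k' by simp
qed

lemma s_sum: "k * (\<Sum>j<k. s j) \<le> s k"
proof (cases k)
  case (Suc n)
  have "(\<Sum>j<Suc n. s j) \<le> (\<Sum>j<Suc n. s n)"
    using strict_mono_less_eq[OF strict_mono_s] by (intro sum_mono) simp
  also have "\<dots> = Suc n * s n" by simp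
  finally have "k * (\<Sum>j<k. s j) \<le> Suc n * (Suc n * s n)" unfolding Suc by (rule mult_le_mono2)
  then show ?thesis using s_sparse[of n] Suc by (simp only: mult.assoc)
qed simp

lemma ins_le: "ins y k \<le> s k"
  by (simp add: ins_def)

lemma inserted_eq: "s k \<le> i \<Longrightarrow> i < s (Suc k) \<Longrightarrow> inserted y i = sum (ins y) {..k}"
proof -
  assume i: "s k \<le> i" "i < s (Suc k)"
  have "s j \<le> i \<longleftrightarrow> j \<le> k" for j
  proof
    assume "s j \<le> i"
    then have "s j < s (Suc k)" using i by linarith
    then show "j \<le> k" using strict_mono_less[OF strict_mono_s] by simp
  next
    assume "j \<le> k"
    then have "s j \<le> s k" using strict_mono_less_eq[OF strict_mono_s] by simp
    then show "s j \<le> i" using i by simp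
  qed
  then have "{j. s j \<le> i} = {..k}" by auto
  then show ?thesis by (simp add: inserted_def)
qed

lemma mono_inserted: "mono (inserted y)"
proof (rule monoI)
  fix i i' :: nat assume "i \<le> i'"
  have "finite {j. s j \<le> i'}"
  proof (rule finite_subset)
    show "{j. s j \<le> i'} \<subseteq> {..i'}" using s_ge by (auto intro: le_trans)
  qed simp
  then show "inserted y i \<le> inserted y i'"
    unfolding inserted_def using \<open>i \<le> i'\<close> by (intro sum_mono2) auto
qed

lemma length_block_word: "length (block_word y k) = s k + sum (ins y) {..k}"
proof (induction k)
  case (Suc k)
  then show ?case using s_less[of k] by simp
qed simp

lemma full_block_word: "full_word (block_word y k)"
proof -
  have full: "full_word (map (digit_seq x) [i..<s k])" if "i < s k" for i k
    using full_word_digits_pivot[OF x s_pivot[of k], of i] that s_pos[of k] by simp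
  show ?thesis
    by (induction k) (auto simp: full full_word_append full_word_replicate_pivot s_pos s_less)
qed

lemma block_word_extends: "\<exists>v. v \<noteq> [] \<and> block_word y (Suc k) = block_word y k @ v"
  using s_less[of k] by (intro exI[of _ "map (digit_seq x) [s k..<s (Suc k)] @ replicate (ins y (Suc k)) pivot"]) simp

lemma block_word_cong: "(\<And>j. j \<le> k \<Longrightarrow> y j = y' j) \<Longrightarrow> block_word y k = block_word y' k"
  by (induction k) (auto simp: ins_def)

lemma count_block_word:
  "count_list (block_word y k) pivot = count_list (map (digit_seq x) [0..<s k]) pivot + sum (ins y) {..k}"
proof (induction k)
  case (Suc k)
  have "[0..<s (Suc k)] = [0..<s k] @ [s k..<s (Suc k)]"
    using upt_add_eq_append[of 0 "s k" "s (Suc k) - s k"] s_less[of k] by simp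
  then show ?case using Suc by (simp add: count_list_replicate_self)
qed (simp add: count_list_replicate_self)

section \<open>The point with inserted pivots and its dependence on \<open>y\<close>\<close>

definition point :: "(nat \<Rightarrow> nat) \<Rightarrow> complex" where
  "point y = (SOME z. z \<in> open_square \<and> (\<forall>k. z \<in> branch (block_word y k) ` closed_square) \<and>
     (\<forall>j. (hurwitz_map ^^ j) z \<noteq> 0) \<and>
     (\<forall>k j. Suc j < length (block_word y k) \<longrightarrow> digit_seq z j = block_word y k ! j))"

lemma point:
  "point y \<in> open_square" "point y \<in> branch (block_word y k) ` closed_square"
  "(hurwitz_map ^^ j) (point y) \<noteq> 0"
  "Suc j < length (block_word y k) \<Longrightarrow> digit_seq (point y) j = block_word y k ! j"
proof -
  have "\<exists>z. z \<in> open_square \<and> (\<forall>k. z \<in> branch (block_word y k) ` closed_square) \<and>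
     (\<forall>j. (hurwitz_map ^^ j) z \<noteq> 0) \<and>
     (\<forall>k j. Suc j < length (block_word y k) \<longrightarrow> digit_seq z j = block_word y k ! j)"
    by (rule full_words_point[of "block_word y", OF full_block_word block_word_extends]) blast
  from someI_ex[OF this, folded point_def]
  show "point y \<in> open_square" "point y \<in> branch (block_word y k) ` closed_square"
    "(hurwitz_map ^^ j) (point y) \<noteq> 0"
    "Suc j < length (block_word y k) \<Longrightarrow> digit_seq (point y) j = block_word y k ! j"
    by blast+
qed

text \<open>The last letter, lost at a finite stage, is recovered from the next, strictly longer
  word.\<close>

lemma point_digit: "j < length (block_word y k) \<Longrightarrow> digit_seq (point y) j = block_word y k ! j"
proof -
  assume j: "j < length (block_word y k)"
  then have "Suc j < length (block_word y (Suc k))" using s_less[of k] by simp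
  then have "digit_seq (point y) j = block_word y (Suc k) ! j" by (rule point(4))
  then show ?thesis using j by (simp add: nth_append)
qed

lemma point_digit_shift: "digit_seq (point y) (i + inserted y i) = digit_seq x i"
proof (cases "s 0 \<le> i")
  case False
  have "inserted y i = 0"
  proof -
    have "\<not> s j \<le> i" for j using False strict_mono_less_eq[OF strict_mono_s, of 0 j] by simp
    then show ?thesis by (simp add: inserted_def)
  qed
  then show ?thesis using point_digit[of i y 0] False by (simp add: nth_append)
next
  case True
  then obtain k where k: "s k \<le> i" "i < s (Suc k)" by (rule s_index)
  have D: "inserted y i = sum (ins y) {..k}" by (rule inserted_eq[OF k])
  have "i + inserted y i < length (block_word y (Suc k))"
    unfolding length_block_word D using k by simp
  then have "digit_seq (point y) (i + inserted y i) = block_word y (Suc k) ! (i + inserted y i)"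
    by (rule point_digit)
  also have "\<dots> = digit_seq x i"
  proof -
    have "i - s k < s (Suc k) - s k" using k by (intro diff_less_mono)
    then show ?thesis using k by (simp add: nth_append length_block_word D)
  qed
  finally show ?thesis .
qed

text \<open>Sequences with a common initial segment share a block word, so both points lie in one
  branch image of the square; its diameter shrinks by the contraction.\<close>

lemma point_continuous:
  assumes "open U" "point y \<in> U"
  shows "\<exists>k. \<forall>y'. (\<forall>j<k. y' j = y j) \<longrightarrow> point y' \<in> U"
proof -
  obtain e where e: "e > 0" "ball (point y) e \<subseteq> U" using assms open_contains_ball by blast
  obtain k where k: "(1/2::real) ^ k < e / 2" using real_arch_pow_inv[of "e / 2" "1/2"] e(1) by auto
  have "point y' \<in> U" if "\<forall>j<Suc k. y' j = y j" for y'
  proof -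
    have "block_word y' k = block_word y k" using that by (intro block_word_cong) auto
    then obtain q q' where q: "q \<in> closed_square" "q' \<in> closed_square"
      "point y = branch (block_word y k) q" "point y' = branch (block_word y k) q'"
      using point(2)[of y k] point(2)[of y' k] by auto
    have "cmod (point y - point y') \<le> (1/2) ^ length (block_word y k) * cmod (q - q')"
      unfolding q(3,4) by (rule branch_contraction[OF full_block_word q(1,2)])
    also have "\<dots> \<le> (1/2) ^ k * 2"
    proof (rule mult_mono)
      show "(1/2::real) ^ length (block_word y k) \<le> (1/2) ^ k"
        using s_ge[of k] by (intro power_decreasing) (auto simp: length_block_word)
      show "cmod (q - q') \<le> 2"
        using norm_triangle_ineq4[of q q'] closed_square_norm[OF q(1)] closed_square_norm[OF q(2)] by linarith
    qed auto
    also have "\<dots> < e" using k by simp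
    finally show ?thesis using e(2) by (auto simp: dist_norm)
  qed
  then show ?thesis by blast
qed

text \<open>With \<open>y k \<ge> m\<close> and \<open>k \<ge> m\<close>, the latest insertion and
  the sum of all earlier ones are each at most \<open>s k / m\<close>. Between \<open>s k\<close>
  and \<open>s (Suc k)\<close> nothing is added, so \<open>2 * i / m\<close> bounds the
  total.\<close>

lemma inserted_sparse:
  assumes "filterlim y at_top sequentially"
  shows "(\<lambda>i. real (inserted y i) / real i) \<longlonglongrightarrow> 0"
proof (rule LIMSEQ_I)
  fix r :: real assume r: "0 < r"
  obtain m :: nat where m: "2 / r < real m" using reals_Archimedean2 by blast
  have "eventually (\<lambda>k. m \<le> y k) sequentially" using assms by (auto simp: filterlim_at_top)
  then obtain K where K: "\<And>k. K \<le> k \<Longrightarrow> m \<le> y k" by (auto simp: eventually_sequentially)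
  have m0: "real m > 0" using m r by (meson less_trans zero_less_divide_iff zero_less_numeral)
  have "norm (real (inserted y i) / real i - 0) < r" if i: "s (max K m) \<le> i" for i
  proof -
    have "s 0 \<le> i" using i strict_mono_less_eq[OF strict_mono_s, of 0 "max K m"] by simp
    then obtain k where k: "s k \<le> i" "i < s (Suc k)" by (rule s_index)
    have "s (max K m) < s (Suc k)" using i k by linarith
    then have Kk: "K \<le> k" "m \<le> k" using strict_mono_less[OF strict_mono_s, of "max K m" "Suc k"] by auto
    have sk: "real (s k) > 0" using s_pos by simp
    have "inserted y i = (\<Sum>j<k. ins y j) + ins y k"
      by (simp add: inserted_eq[OF k] lessThan_Suc_atMost[symmetric])
    then have "real (inserted y i) = real (\<Sum>j<k. ins y j) + real (ins y k)" by simp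
    moreover have "real m * real (ins y k) \<le> real (s k)"
    proof -
      have "m * ins y k \<le> Suc (y k) * (s k div Suc (y k))"
        unfolding ins_def using K[OF Kk(1)] by (intro mult_le_mono1) simp
      also have "\<dots> \<le> s k" by (rule times_div_less_eq_dividend)
      finally show ?thesis by (metis of_nat_le_iff of_nat_mult)
    qed
    moreover have "real m * real (\<Sum>j<k. ins y j) \<le> real (s k)"
    proof -
      have "m * (\<Sum>j<k. ins y j) \<le> k * (\<Sum>j<k. s j)"
        using Kk by (intro mult_le_mono sum_mono ins_le)
      also have "\<dots> \<le> s k" by (rule s_sum)
      finally show ?thesis by (metis of_nat_le_iff of_nat_mult)
    qed
    ultimately have "real m * real (inserted y i) \<le> 2 * real (s k)" by (simp add: distrib_left)
    also have "\<dots> \<le> 2 * real i" using k by simp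
    finally have *: "real m * real (inserted y i) \<le> 2 * real i" .
    have i0: "real i > 0" using k sk by linarith
    have "2 < r * real m" using m r by (simp add: field_simps)
    then have "2 * real i < r * real m * real i" using i0 by simp
    with * have "real m * real (inserted y i) < real m * (r * real i)" by (simp add: mult_ac)
    then have "real (inserted y i) < r * real i" using m0 by simp
    then show ?thesis using i0 by (simp add: pos_divide_less_eq)
  qed
  then show "\<exists>no. \<forall>i\<ge>no. norm (real (inserted y i) / real i - 0) < r" by blast
qed

lemma point_domain: "point y \<in> hurwitz_domain - gaussian_rationals"
proof -
  have "point y \<in> hurwitz_domain" using point(1) open_square_subset_domain by blast
  then show ?thesis using gaussian_rational_orbit_zero point(3) by blast
qed

lemma point_normal:
  assumes "filterlim y at_top sequentially"
  shows "point y \<in> hurwitz_normal M"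
  unfolding hurwitz_normal_iff
proof (intro conjI point_domain allI impI)
  fix b :: "complex list" assume "b \<noteq> [] \<and> regular_word b"
  then have "b \<in> lists gauss_ints" using regular_word_gauss by blast
  then show "(\<lambda>N. real (card (occurrences (digit_seq (point y)) b N)) / real N) \<longlonglongrightarrow> measure M (hurwitz_cylinder b)"
    by (intro frequency_insertion[of "inserted y" "digit_seq (point y)" "digit_seq x"]
        mono_inserted point_digit_shift inserted_sparse[OF assms] freq)
qed

text \<open>The pivot frequency is read at the end of each block word, just after the insertion.
  There it equals \<open>(cnt k + H k) / (s k + H k)\<close>, while \<open>cnt k / s k\<close> tends
  to \<open>p\<close> as well; comparing the two isolates \<open>(1 - p) * H k / s k\<close>, and
  \<open>p < 1\<close> forces \<open>H k / s k\<close> to vanish.\<close>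

lemma normal_point_tendsto:
  assumes "point y \<in> hurwitz_normal M"
  shows "filterlim y at_top sequentially"
proof -
  define p where "p = measure M (hurwitz_cylinder [pivot])"
  define H where "H k = real (sum (ins y) {..k})" for k
  define cnt where "cnt k = real (card (occurrences (digit_seq x) [pivot] (s k)))" for k
  have p: "p < 1" using cylinder_pivot_measure(2)[OF M] by (simp add: p_def)
  have sp: "real (s k) > 0" for k using s_pos by simp
  have H0: "0 \<le> H k" for k unfolding H_def by (rule of_nat_0_le_iff)
  have "(\<lambda>N. real (card (occurrences (digit_seq x) [pivot] N)) / real N) \<longlonglongrightarrow> p"
    unfolding p_def using pivot_gauss by (intro freq) simp
  from LIMSEQ_subseq_LIMSEQ[OF this strict_mono_s]
  have lim1: "(\<lambda>k. cnt k / real (s k)) \<longlonglongrightarrow> p" by (simp add: cnt_def comp_def)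
  have "strict_mono (\<lambda>k. length (block_word y k))"
    using s_less by (simp add: strict_mono_Suc_iff)
  moreover have "(\<lambda>N. real (card (occurrences (digit_seq (point y)) [pivot] N)) / real N) \<longlonglongrightarrow> p"
    using assms regular_pivot by (auto simp: hurwitz_normal_iff p_def)
  moreover have "real (card (occurrences (digit_seq (point y)) [pivot] (length (block_word y k)))) = cnt k + H k" for k
  proof -
    have "map (digit_seq (point y)) [0..<length (block_word y k)] = block_word y k"
      by (intro nth_equalityI) (auto simp: point_digit)
    then show ?thesis by (simp add: card_occurrences_singleton cnt_def H_def count_block_word)
  qed
  moreover have "real (length (block_word y k)) = real (s k) + H k" for k
    by (simp add: length_block_word H_def)
  ultimately have lim2: "(\<lambda>k. (cnt k + H k) / (real (s k) + H k)) \<longlonglongrightarrow> p"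
    using LIMSEQ_subseq_LIMSEQ[of "\<lambda>N. real (card (occurrences (digit_seq (point y)) [pivot] N)) / real N" p
        "\<lambda>k. length (block_word y k)"] by (simp add: comp_def)
  \<comment> \<open>The last insertion and the sum of the earlier ones are each at most
    \<open>s k\<close>; the crude bound keeps the factor \<open>1 + H k / s k\<close> below
    3.\<close>
  have H2: "H k / real (s k) \<le> 2" for k
  proof -
    have "sum (ins y) {..k} = (\<Sum>j<k. ins y j) + ins y k" by (simp add: lessThan_Suc_atMost[symmetric])
    also have "\<dots> \<le> (\<Sum>j<k. s j) + s k" by (intro add_mono sum_mono ins_le)
    also have "(\<Sum>j<k. s j) \<le> s k" using s_sum[of k] by (cases k) auto
    finally have "H k \<le> 2 * real (s k)" unfolding H_def by linarith
    then show ?thesis using sp[of k] by (simp add: pos_divide_le_eq)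
  qed
  have "(\<lambda>k. (1 - p) * (H k / real (s k))) \<longlonglongrightarrow> 0"
  proof (rule Lim_null_comparison)
    show "eventually (\<lambda>k. norm ((1 - p) * (H k / real (s k))) \<le>
        3 * \<bar>(cnt k + H k) / (real (s k) + H k) - p\<bar> + \<bar>cnt k / real (s k) - p\<bar>) sequentially"
    proof (intro always_eventually allI)
      fix k
      let ?d = "H k / real (s k)" and ?F = "(cnt k + H k) / (real (s k) + H k)"
      have "real (s k) + H k \<noteq> 0" using sp[of k] H0[of k] by linarith
      then have "?F * ((real (s k) + H k) / real (s k)) = (cnt k + H k) / real (s k)" by simp
      moreover have "1 + ?d = (real (s k) + H k) / real (s k)"
        using sp[of k] by (simp add: add_divide_distrib)
      ultimately have F: "?F * (1 + ?d) = cnt k / real (s k) + ?d"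
        by (simp only: add_divide_distrib[of "cnt k" "H k" "real (s k)"])
      have "(1 - p) * d = (f - p) * (1 + d) - (c - p)" if "f * (1 + d) = c + d" for f c d :: real
        using that by (simp add: algebra_simps)
      from this[OF F] have "(1 - p) * ?d = (?F - p) * (1 + ?d) - (cnt k / real (s k) - p)" .
      then have "\<bar>(1 - p) * ?d\<bar> \<le> \<bar>(?F - p) * (1 + ?d)\<bar> + \<bar>cnt k / real (s k) - p\<bar>"
        by (simp only: abs_triangle_ineq4)
      also have "\<bar>(?F - p) * (1 + ?d)\<bar> \<le> \<bar>?F - p\<bar> * 3"
        unfolding abs_mult using H2[of k] H0[of k] sp[of k] by (intro mult_left_mono) auto
      finally show "norm ((1 - p) * ?d) \<le> 3 * \<bar>?F - p\<bar> + \<bar>cnt k / real (s k) - p\<bar>" by simp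
    qed
    have "(\<lambda>k. 3 * \<bar>(cnt k + H k) / (real (s k) + H k) - p\<bar> + \<bar>cnt k / real (s k) - p\<bar>) \<longlonglongrightarrow>
        3 * \<bar>p - p\<bar> + \<bar>p - p\<bar>"
      by (intro tendsto_intros lim1 lim2)
    then show "(\<lambda>k. 3 * \<bar>(cnt k + H k) / (real (s k) + H k) - p\<bar> + \<bar>cnt k / real (s k) - p\<bar>) \<longlonglongrightarrow> 0"
      by simp
  qed
  then have "(\<lambda>k. 1 / (1 - p) * ((1 - p) * (H k / real (s k)))) \<longlonglongrightarrow> 1 / (1 - p) * 0"
    by (intro tendsto_intros)
  then have limH: "(\<lambda>k. H k / real (s k)) \<longlonglongrightarrow> 0" using p by simp
  have "eventually (\<lambda>k. Z \<le> y k) sequentially" for Z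
  proof (cases "Z = 0")
    case False
    then have Z: "real Z > 0" by simp
    \<comment> \<open>If \<open>y k < Z\<close>, at least \<open>s k div Z\<close> pivots are
      inserted. For \<open>s k \<ge> 2 * Z\<close> the floor loses at most half of
      \<open>s k / Z\<close>, hence the threshold \<open>1 / (2 * Z)\<close>.\<close>
    have "eventually (\<lambda>k. H k / real (s k) < 1 / (2 * real Z)) sequentially"
      using limH Z by (intro order_tendstoD(2)) auto
    moreover have "eventually (\<lambda>k. 2 * Z \<le> k) sequentially" by (rule eventually_ge_at_top)
    ultimately show ?thesis
    proof eventually_elim
      case (elim k)
      show ?case
      proof (rule ccontr)
        assume "\<not> Z \<le> y k"
        then have "Suc (y k) \<le> Z" by simp
        then have "s k div Z \<le> ins y k" unfolding ins_def by (intro div_le_mono2) auto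
        moreover have "ins y k \<le> sum (ins y) {..k}" by (intro member_le_sum) auto
        ultimately have le: "s k div Z \<le> sum (ins y) {..k}" by linarith
        have "s k < Z * (s k div Z) + Z"
          using False by (metis add_less_cancel_left mod_less_divisor mult_div_mod_eq neq0_conv)
        also have "\<dots> \<le> Z * sum (ins y) {..k} + Z" using le by simp
        finally have "real (s k) < real Z * H k + real Z"
          unfolding H_def by (metis of_nat_add of_nat_less_iff of_nat_mult)
        moreover have "2 * real Z * H k < real (s k)" using elim(1) Z sp[of k] by (simp add: field_simps)
        moreover have "2 * real Z \<le> real (s k)" using elim(2) s_ge[of k] by linarith
        ultimately show False by linarith
      qed
    qed
  qed simp
  then show ?thesis by (simp add: filterlim_at_top)
qed

lemma not_Sigma_3: "\<not> borel_Sigma 3 (hurwitz_normal M)"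
proof (rule not_borel_Sigma_3I)
  show "point y \<in> hurwitz_normal M \<longleftrightarrow> filterlim y at_top sequentially" for y
    using point_normal normal_point_tendsto by blast
qed (rule point_continuous)

end

lemma hurwitz_normal_not_Sigma_3:
  assumes M: "hurwitz_measure M"
  shows "\<not> borel_Sigma 3 (hurwitz_normal M)"
proof -
  obtain x where x: "x \<in> hurwitz_domain" "\<And>j. (hurwitz_map ^^ j) x \<noteq> 0"
    "\<And>b. b \<in> lists gauss_ints \<Longrightarrow>
      (\<lambda>N. real (card (occurrences (digit_seq x) b N)) / real N) \<longlonglongrightarrow> measure M (hurwitz_cylinder b)"
    using generic_point[OF M] by blast
  have piv: "\<exists>j\<ge>i. digit_seq x j = pivot" for i
    using frequency_pivot_imp[OF M x(3)] pivot_gauss by simp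
  have "\<exists>s. \<forall>k. (0 < s k \<and> digit_seq x (s k - 1) = pivot) \<and> (s k < s (Suc k) \<and> Suc k * Suc k * s k \<le> s (Suc k))"
  proof (rule dependent_nat_choice)
    obtain j where "digit_seq x j = pivot" using piv by blast
    then show "\<exists>n. 0 < n \<and> digit_seq x (n - 1) = pivot" by (intro exI[of _ "Suc j"]) simp
    show "\<exists>n'. (0 < n' \<and> digit_seq x (n' - 1) = pivot) \<and> n < n' \<and> Suc k * Suc k * n \<le> n'" for n k
    proof -
      \<comment> \<open>The next position is \<open>Suc j\<close>, just behind a pivot; taking
        \<open>n\<close> into the maximum also ensures strict growth.\<close>
      obtain j where "max n (Suc k * Suc k * n) \<le> j" "digit_seq x j = pivot" using piv by blast
      then show ?thesis by (intro exI[of _ "Suc j"]) simp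
    qed
  qed
  then obtain s where "pivot_insertion M x s"
    using M x by (auto simp: pivot_insertion_def)
  then show ?thesis by (rule pivot_insertion.not_Sigma_3)
qed

theorem theorem5p1:
  fixes \<mu>\<^sub>H :: "complex measure"
  assumes "hurwitz_measure \<mu>\<^sub>H"
  shows "borel_Pi 3 (hurwitz_normal \<mu>\<^sub>H) \<and> \<not> borel_Sigma 3 (hurwitz_normal \<mu>\<^sub>H)"
  using hurwitz_normal_Pi_3[OF assms] hurwitz_normal_not_Sigma_3[OF assms] by blast

end
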